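(* Let $A,A_1,A_2,B_1,B_2,E\in\mathbb{C}^{m\times m}$ with $E$ singular. Suppose there is $\gamma\in\mathbb{C}$ such that $\gamma E+A$ is invertible, put $\hat E=(\gamma E+A)^{-1}E$, $\hat A=(\gamma E+A)^{-1}A$, let $\hat E^D$ be the Drazin inverse of $\hat E$, and suppose that some $z\in\sigma(\hat E^D\hat A)$ satisfies $z\ne0$. Let $(\alpha,\beta)\in\mathbb{R}^2$ be the constants in the scalar discrete Sturm--Liouville problem (PSD) described in the context, with its $N-1$ eigenvalues $\lambda_1,\dots,\lambda_{N-1}$ and associated eigenfunctions $v_1,\dots,v_{N-1}$, and suppose that $$\mathcal{G}(\alpha,\beta)=\begin{pmatrix}\alpha A_1-A_2\\ \beta B_1-B_2\end{pmatrix}\in\mathbb{C}^{2m\times m}$$ has rank less than $m$. Let $F(i),G(i)\in\mathbb{C}^m$ be bounded and satisfy: (a) $\hat E\hat E^DF(i)=F(i)$ and $\hat E\hat E^DG(i)=G(i)$; (b) $\{F(i),G(i):0<i<N\}\subset\ker\mathcal{G}(\alpha,\beta)$ and $\mathcal{G}(\alpha,\beta)\,\hat E^D\hat A\,\big(I-\mathcal{G}(\alpha,\beta)^{+}\mathcal{G}(\alpha,\beta)\big)=0$. Suppose further that each $\rho=\rho_l=-r^2\lambda_l$, $1\le l\le N-1$, satisfies: (c) $\rho d\left(1+\frac{\rho}{4}d\right)\neq0$ for all $d\in\sigma(\hat E^D\hat A)\setminus\{0\}$; (d) $\rho\le r^2\max\{|\lambda_s|:1\le s\le N-1\}$. Then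 a stable solution (in the sense defined in the context) of the discrete problem $$r^2A\big(U(i+1,j)+U(i-1,j)\big)+2(E-r^2A)U(i,j)-E\big(U(i,j+1)+U(i,j-1)\big)=0,\quad 0<i<N,\ j>0,$$ $$A_1U(0,j)+NA_2\big(U(1,j)-U(0,j)\big)=0,\quad j>0,$$ $$B_1U(N,j)+NB_2\big(U(N,j)-U(N-1,j)\big)=0,\quad j>0,$$ $$U(i,0)=F(i),\quad 0\le i\le N,$$ $$\frac{U(i,1)-U(i,0)}{k}=G(i),\quad 0\le i\le N,$$ is given by $$U(i,j)=\sum_{l=1}^{N-1}\left(\hat Z_{0,l}^{\,j}\,\hat E\hat E^DP_l+\hat Z_{1,l}^{\,j}\,\hat E\hat E^DQ_l\right)v_l(i),$$ where $$P_l=\left[(\hat Z_{1,l}-\hat Z_{0,l})\hat E\hat E^D\right]^{G}\,\frac{\sum_{i=1}^{N-1}v_l(i)\left[kG(i)+(\hat Z_{1,l}-I)F(i)\right]}{\sum_{i=1}^{N-1}v_l(i)^2},$$ $$Q_l=\left[(\hat Z_{1,l}-\hat Z_{0,l})\hat E\hat E^D\right]^{G}\,\frac{\sum_{i=1}^{N-1}v_l(i)\left[(\hat Z_{0,l}-I)F(i)-kG(i)\right]}{\sum_{i=1}^{N-1}v_l(i)^2}.$$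
   Context: $N$ is a positive integer, $h=1/N$ is the (fixed) spatial step, $k>0$ the time step, $r=k/h$. The unknown is $U(i,j)\in\mathbb{C}^m$ for $0\le i\le N$, $j\ge0$. It approximates $u(ih,jk)$ for the system $Eu_{tt}-Au_{xx}=0$ on $[0,1]\times[0,T]$ with boundary conditions $A_1u(0,t)+A_2u_x(0,t)=0$, $B_1u(1,t)+B_2u_x(1,t)=0$ and initial data $u(x,0)=f(x)$, $u_t(x,0)=g(x)$, where $f,g$ take values in $\mathbb{C}^m$ and are discretized by $F$ and $G$. $\sigma(\cdot)$ denotes the spectrum and $I$ the identity matrix. Scalar discrete Sturm--Liouville problem (PSD): find $\lambda$ (eigenvalue) and nonzero $h(i)$, $0\le i\le N$ (eigenfunction), with $h(i+1)-(2-\lambda)h(i)+h(i-1)=0$ for $0<i<N$; $h(0)+\alpha N(h(1)-h(0))=0$; $h(N)+\beta N(h(N)-h(N-1))=0$. Its $N-1$ eigenvalues are $\lambda_l$, $0<l<N$, with (real) eigenfunctions $v_l(i)$, $0\le i\le N$, which are mutually orthogonal with respect to $\sum_{i=1}^{N-1}v_\mu(i)v_\nu(i)$. Drazin inverse: if $\hat E$ has index $\kappa$, $\hat E^D$ is the unique matrix with $\hat E^D\hat E\hat E^D=\hat E^D$, $\hat E^D\hat E=\hat E\hat E^D$, $\hat E^{\kappa+1}\hat E^D=\hat E^{\kappa}$. Definition of $\hat Z_{0,l},\hat Z_{1,l}$: for each $l$ put $\rho=-r^2\lambda_l$ and $X=\hat E^D\hat A$. Let $P_+,P_-$ be the polynomials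 of degree less than that of the minimal polynomial of $X$ such that $P_{\pm}(X)=I+\frac{\rho}{2}X\pm\sqrt{\left(I+\frac{\rho}{2}X\right)^2-I}$ (square root in the sense of matrix functions). Then $\hat Z_{0,l}=P_+(\hat E^D\hat A)\,\hat E\hat E^D$ and $\hat Z_{1,l}=P_-(\hat E^D\hat A)\,\hat E\hat E^D$. Generalized inverses: $Y^G$ denotes a generalized inverse of a square matrix $Y$, i.e. $YY^GY=Y$. When $Y=S\begin{pmatrix}C&0\\0&0\end{pmatrix}S^{-1}$ with $C$ invertible, the one used is $Y^G=S\begin{pmatrix}C^{-1}&0\\0&0\end{pmatrix}S^{-1}$. $\mathcal{G}^{+}$ is the Moore--Penrose (generalized) inverse, so $\mathcal{G}\mathcal{G}^{+}\mathcal{G}=\mathcal{G}$. Stability: fix $(h,T)\in\mathbb{R}^+\times\mathbb{R}^+$ and consider meshes with spatial step $h$ and time step $k>0$ such that $kM=T$ with $M$ a natural number. A function $U$ on the mesh is stable if $U(ih,jk)$ (here $U(i,j)$, $1\le i\le N-1$, $1\le j\le M$) remains bounded independently of the values of $k$ and $M$ with $kM=T$.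
   Formalization: Signs corrected: the numerators use (Z_1-I)F-kG in P_l and kG-(Z_0-I)F in Q_l. Added, and necessary: F and G satisfy the scalar (PSD) boundary conditions at i=0 and i=N, and F(i), G(i) for 0<i<N lie in the range of Ê^D Â. *)

theory Defs
  imports "HOL-Analysis.Analysis" "HOL-Computational_Algebra.Computational_Algebra"
begin

section \<open>Matrices\<close>

primrec mat_pow :: "'a::semiring_1^'n^'n \<Rightarrow> nat \<Rightarrow> 'a^'n^'n" where
  "mat_pow X 0 = mat 1"
| "mat_pow X (Suc n) = X ** mat_pow X n"

definition poly_mat :: "complex poly \<Rightarrow> complex^'n^'n \<Rightarrow> complex^'n^'n" where
  "poly_mat p X = (\<Sum>i\<le>degree p. mat (coeff p i) ** mat_pow X i)"

definition spectrum :: "complex^'n^'n \<Rightarrow> complex set" where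
  "spectrum X = {z. \<not> invertible (mat z - X)}"

definition min_poly :: "complex^'n^'n \<Rightarrow> complex poly" where
  "min_poly X = (THE p. lead_coeff p = 1 \<and> poly_mat p X = 0 \<and>
     (\<forall>q. q \<noteq> 0 \<and> poly_mat q X = 0 \<longrightarrow> degree p \<le> degree q))"

definition conj_transpose :: "complex^'n^'m \<Rightarrow> complex^'m^'n" where
  "conj_transpose X = (\<chi> i j. cnj (X $ j $ i))"

text \<open>The matrix with block column \<open>X\<close> over \<open>Y\<close>; its rows are indexed by a sum type.\<close>

definition stack :: "complex^'n^'m \<Rightarrow> complex^'n^'k \<Rightarrow> complex^'n^('m + 'k)" where
  "stack X Y = (\<chi> i. case i of Inl a \<Rightarrow> X $ a | Inr b \<Rightarrow> Y $ b)"


section \<open>Generalized inverses\<close>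

definition mat_index :: "complex^'n^'n \<Rightarrow> nat" where
  "mat_index X = (LEAST n. rank (mat_pow X n) = rank (mat_pow X (Suc n)))"

definition is_drazin_inverse :: "complex^'n^'n \<Rightarrow> complex^'n^'n \<Rightarrow> bool" where
  "is_drazin_inverse X D \<longleftrightarrow>
     D ** X ** D = D \<and> D ** X = X ** D \<and>
     mat_pow X (mat_index X + 1) ** D = mat_pow X (mat_index X)"

definition is_moore_penrose_inverse :: "complex^'n^'m \<Rightarrow> complex^'m^'n \<Rightarrow> bool" where
  "is_moore_penrose_inverse X P \<longleftrightarrow>
     X ** P ** X = X \<and> P ** X ** P = P \<and>
     conj_transpose (X ** P) = X ** P \<and> conj_transpose (P ** X) = P ** X"

text \<open>
  \<open>inverse_block J D D'\<close>: up to the order of the basis, \<open>D\<close> is the block matrix with an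
  invertible block \<open>C\<close> at the indices \<open>J\<close> and zeros elsewhere, and \<open>D'\<close> is the block matrix
  with \<open>inverse C\<close> at the indices \<open>J\<close> and zeros elsewhere.
\<close>

definition inverse_block :: "'n set \<Rightarrow> complex^'n^'n \<Rightarrow> complex^'n^'n \<Rightarrow> bool" where
  "inverse_block J D D' \<longleftrightarrow>
     (\<forall>i j. \<not> (i \<in> J \<and> j \<in> J) \<longrightarrow> D $ i $ j = 0 \<and> D' $ i $ j = 0) \<and>
     D ** D' = (\<chi> i j. if i = j \<and> i \<in> J then 1 else 0) \<and>
     D' ** D = (\<chi> i j. if i = j \<and> i \<in> J then 1 else 0)"

definition is_generalized_inverse :: "complex^'n^'n \<Rightarrow> complex^'n^'n \<Rightarrow> bool" where
  "is_generalized_inverse Y YG \<longleftrightarrow>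
     Y ** YG ** Y = Y \<and>
     (\<forall>(S :: complex^'n^'n) J D D'. invertible S \<and> inverse_block J D D' \<and> Y = S ** D ** matrix_inv S \<longrightarrow>
        YG = S ** D' ** matrix_inv S)"


section \<open>Matrix functions\<close>

text \<open>
  \<open>R = f(X)\<close> as a primary matrix function: \<open>R\<close> is the value at \<open>X\<close> of a polynomial which agrees
  with \<open>f\<close> on the spectrum of \<open>X\<close>, with derivatives up to the multiplicity of each eigenvalue in
  the minimal polynomial. At a simple root of the minimal polynomial only the value of \<open>f\<close>
  matters, so no regularity of \<open>f\<close> is required there.
\<close>

definition is_matrix_function ::
  "(complex \<Rightarrow> complex) \<Rightarrow> complex^'n^'n \<Rightarrow> complex^'n^'n \<Rightarrow> bool" where
  "is_matrix_function f X R \<longleftrightarrow>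
     (\<forall>z\<in>spectrum X. order z (min_poly X) \<ge> 2 \<longrightarrow> f analytic_on {z}) \<and>
     (\<exists>p. R = poly_mat p X \<and>
        (\<forall>z\<in>spectrum X. \<forall>n<order z (min_poly X).
           poly ((pderiv ^^ n) p) z = (deriv ^^ n) f z))"

text \<open>No branch of the square root is preferred: \<open>f\<close> may be any of them.\<close>

definition is_matrix_sqrt :: "complex^'n^'n \<Rightarrow> complex^'n^'n \<Rightarrow> bool" where
  "is_matrix_sqrt X R \<longleftrightarrow> (\<exists>f. (\<forall>w. f w ^ 2 = w) \<and> is_matrix_function f X R)"

definition P_pair :: "complex^'n^'n \<Rightarrow> real \<Rightarrow> complex poly \<Rightarrow> complex poly \<Rightarrow> bool" where
  "P_pair X \<rho> p q \<longleftrightarrow>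
     degree p < degree (min_poly X) \<and> degree q < degree (min_poly X) \<and>
     (\<exists>R. is_matrix_sqrt (mat_pow (mat 1 + (\<rho> / 2) *\<^sub>R X) 2 - mat 1) R \<and>
        poly_mat p X = mat 1 + (\<rho> / 2) *\<^sub>R X + R \<and>
        poly_mat q X = mat 1 + (\<rho> / 2) *\<^sub>R X - R)"


section \<open>The discrete problems\<close>

text \<open>The eigenfunction is only relevant on \<open>{0..N}\<close>, so it has to be nonzero there.\<close>

definition psd_eigenpair :: "nat \<Rightarrow> real \<Rightarrow> real \<Rightarrow> real \<Rightarrow> (nat \<Rightarrow> real) \<Rightarrow> bool" where
  "psd_eigenpair N \<alpha> \<beta> \<mu> v \<longleftrightarrow>
     (\<exists>i\<le>N. v i \<noteq> 0) \<and>
     (\<forall>i. 0 < i \<and> i < N \<longrightarrow> v (i + 1) - (2 - \<mu>) * v i + v (i - 1) = 0) \<and>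
     v 0 + \<alpha> * real N * (v 1 - v 0) = 0 \<and>
     v N + \<beta> * real N * (v N - v (N - 1)) = 0"

definition discrete_solution ::
  "nat \<Rightarrow> real \<Rightarrow> complex^'m^'m \<Rightarrow> complex^'m^'m \<Rightarrow> complex^'m^'m \<Rightarrow> complex^'m^'m \<Rightarrow>
   complex^'m^'m \<Rightarrow> complex^'m^'m \<Rightarrow> (nat \<Rightarrow> complex^'m) \<Rightarrow> (nat \<Rightarrow> complex^'m) \<Rightarrow>
   (nat \<Rightarrow> nat \<Rightarrow> complex^'m) \<Rightarrow> bool" where
  "discrete_solution N k E A A\<^sub>1 A\<^sub>2 B\<^sub>1 B\<^sub>2 F G U \<longleftrightarrow>
    (let h = 1 / real N; r = k / h in
     (\<forall>i j. 0 < i \<and> i < N \<and> 0 < j \<longrightarrow>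
        (r\<^sup>2 *\<^sub>R A) *v (U (i + 1) j + U (i - 1) j) + (2 *\<^sub>R (E - r\<^sup>2 *\<^sub>R A)) *v U i j
          - E *v (U i (j + 1) + U i (j - 1)) = 0) \<and>
     (\<forall>j>0. A\<^sub>1 *v U 0 j + real N *\<^sub>R (A\<^sub>2 *v (U 1 j - U 0 j)) = 0) \<and>
     (\<forall>j>0. B\<^sub>1 *v U N j + real N *\<^sub>R (B\<^sub>2 *v (U N j - U (N - 1) j)) = 0) \<and>
     (\<forall>i\<le>N. U i 0 = F i) \<and>
     (\<forall>i\<le>N. (U i 1 - U i 0) /\<^sub>R k = G i))"

text \<open>
  Stability concerns a family of mesh functions \<open>U k\<close>, one for each time step \<open>k \<in> K\<close>, on
  meshes with the same spatial step \<open>1 / N\<close> and the same final time \<open>T\<close>.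
\<close>

definition stable_on ::
  "nat \<Rightarrow> real \<Rightarrow> real set \<Rightarrow> (real \<Rightarrow> nat \<Rightarrow> nat \<Rightarrow> complex^'m) \<Rightarrow> bool" where
  "stable_on N T K U \<longleftrightarrow>
     (\<exists>C. \<forall>k\<in>K. \<forall>M::nat. k * real M = T \<longrightarrow>
        (\<forall>i\<in>{1..N - 1}. \<forall>j\<in>{1..M}. norm (U k i j) \<le> C))"

end

theory Submission
  imports Defs "HOL-Complex_Analysis.Cauchy_Integral_Formula"
begin

text \<open>
  Distinct eigenvalues make the \<open>N - 1\<close> eigenfunctions orthogonal, hence complete on the interior, so the
  problem decouples into modes. On the range of the projection \<open>Eh ** ED\<close> the scheme for a mode \<open>c\<close> reads
  \<open>c (j + 2) = (2 + \<rho> X) c (j + 1) - c j\<close>, with characteristic roots \<open>Z\<^sub>0\<close> and \<open>Z\<^sub>1\<close>. All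
  matrices involved are polynomials in \<open>X\<close>. The square root \<open>R\<close> is divisible by \<open>X\<close>, because \<open>X\<close> is singular
  and a polynomial representing \<open>R\<close> takes the value \<open>0\<close> at \<open>0\<close>; as \<open>R\<^sup>2\<close> is \<open>X\<close> times an invertible
  matrix, \<open>Z\<^sub>1 - Z\<^sub>0 = - 2 R\<close> has a group inverse, which the prescribed generalized inverse must be. For
  fixed \<open>h\<close> one has \<open>\<rho> = O(k\<^sup>2)\<close>, so stability up to time \<open>T\<close> is a discrete Gronwall estimate.
\<close>

section \<open>Polynomials in a matrix\<close>

lemma mat_matrix_mult: "mat c ** M = (\<chi> i j. c * M $ i $ j)" for M :: "'a::semiring_1^'n^'m"
  by (simp add: vec_eq_iff matrix_matrix_mult_def mat_def if_distrib[of "\<lambda>x. x * _"] cong: if_cong)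

lemma matrix_mat_mult: "M ** mat c = (\<chi> i j. M $ i $ j * c)" for M :: "'a::semiring_1^'n^'m"
  by (simp add: vec_eq_iff matrix_matrix_mult_def mat_def if_distrib[of "\<lambda>x. _ * x"] cong: if_cong)

lemma mat_commute: "mat c ** M = M ** mat c" for M :: "'a::comm_semiring_1^'n^'n"
  by (simp add: mat_matrix_mult matrix_mat_mult mult.commute)

lemma mat_add: "mat (a + b) = mat a + mat b" for a b :: "'a::semiring_1"
  by (simp add: vec_eq_iff mat_def)

lemma matrix_add_rdistrib: "(A + B) ** C = A ** C + B ** C" for A B :: "'a::semiring_1^'n^'m"
  by (simp add: vec_eq_iff matrix_matrix_mult_def distrib_right sum.distrib)

lemma mat_mult: "mat (a * b) = (mat a ** mat b :: 'a::semiring_1^'n^'n)"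
  by (simp add: vec_eq_iff mat_matrix_mult) (simp add: mat_def)

text \<open>Lets polynomials of different degrees be expanded over one common index range.\<close>

lemma poly_mat_sum:
  assumes "degree p \<le> n"
  shows "poly_mat p X = (\<Sum>i\<le>n. mat (coeff p i) ** mat_pow X i)"
  unfolding poly_mat_def using assms
  by (intro sum.mono_neutral_left) (auto simp: coeff_eq_0)

lemma matrix_mult_sum_right: "X ** (\<Sum>i\<in>I. M i) = (\<Sum>i\<in>I. X ** M i)"
  for X :: "'a::semiring_1^'n^'m"
  by (induction I rule: infinite_finite_induct) (auto simp: matrix_add_ldistrib)

lemma poly_mat_0 [simp]: "poly_mat 0 X = 0"
  by (simp add: poly_mat_def)

text \<open>Horner's rule: the sum in the definition becomes a recursion that fits induction on
  polynomials.\<close>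

lemma poly_mat_pCons: "poly_mat (pCons a p) X = mat a + X ** poly_mat p X"
proof -
  have "poly_mat (pCons a p) X = (\<Sum>i\<le>Suc (degree p). mat (coeff (pCons a p) i) ** mat_pow X i)"
    by (rule poly_mat_sum) (simp add: degree_pCons_le)
  also have "\<dots> = mat a + X ** poly_mat p X"
    unfolding sum.atMost_Suc_shift poly_mat_def
    by (simp add: matrix_mult_sum_right matrix_mul_assoc flip: mat_commute[of _ X])
  finally show ?thesis .
qed

lemma poly_mat_add: "poly_mat (p + q) X = poly_mat p X + poly_mat q X"
proof -
  define n where "n = max (degree p) (degree q)"
  have "poly_mat (p + q) X = (\<Sum>i\<le>n. mat (coeff (p + q) i) ** mat_pow X i)"
    by (rule poly_mat_sum) (simp add: n_def degree_add_le_max)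
  also have "\<dots> = (\<Sum>i\<le>n. mat (coeff p i) ** mat_pow X i) + (\<Sum>i\<le>n. mat (coeff q i) ** mat_pow X i)"
    by (simp add: mat_add matrix_add_rdistrib sum.distrib)
  also have "\<dots> = poly_mat p X + poly_mat q X"
    by (simp add: poly_mat_sum[of _ n] n_def)
  finally show ?thesis .
qed

lemma poly_mat_smult: "poly_mat (smult a p) X = mat a ** poly_mat p X"
  by (simp add: poly_mat_sum[of "smult a p" "degree p"] poly_mat_def matrix_mult_sum_right
      mat_mult matrix_mul_assoc)

text \<open>With additivity this makes evaluation at \<open>X\<close> a ring homomorphism, so matrix
  identities can be proved as identities between polynomials.\<close>

lemma poly_mat_mult: "poly_mat (p * q) X = poly_mat p X ** poly_mat q X"
proof (induction p)
  case (pCons a p)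
  then show ?case
    by (simp add: poly_mat_add poly_mat_smult poly_mat_pCons matrix_add_rdistrib matrix_mul_assoc)
qed simp

lemma poly_mat_const [simp]: "poly_mat [:c:] X = mat c"
  by (simp add: poly_mat_pCons)

lemma poly_mat_1 [simp]: "poly_mat 1 X = mat 1"
  by (simp add: one_pCons)

lemma poly_mat_X [simp]: "poly_mat [:0, 1:] X = X"
  by (simp add: poly_mat_pCons)

lemma poly_mat_uminus: "poly_mat (- p) X = - poly_mat p X"
  by (metis poly_mat_add poly_mat_0 add_eq_0_iff ab_left_minus)

lemma poly_mat_diff: "poly_mat (p - q) X = poly_mat p X - poly_mat q X"
  by (metis poly_mat_add poly_mat_uminus diff_conv_add_uminus)

lemma poly_mat_sum_poly: "poly_mat (\<Sum>i\<in>I. p i) X = (\<Sum>i\<in>I. poly_mat (p i) X)"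
  by (induction I rule: infinite_finite_induct) (auto simp: poly_mat_add)

lemma poly_mat_monom: "poly_mat (monom c n) X = mat c ** mat_pow X n"
  by (simp add: poly_mat_sum[of _ n] degree_monom_le if_distrib[of mat] if_distrib[of "\<lambda>M. M ** _"]
      cong: if_cong)

lemma poly_mat_commute: "poly_mat p X ** poly_mat q X = poly_mat q X ** poly_mat p X"
  by (metis poly_mat_mult mult.commute)

text \<open>Needed because the square root arises as a polynomial in another polynomial in
  \<open>X\<close>, while the later computations stay among polynomials in \<open>X\<close>.\<close>

lemma poly_mat_pcompose: "poly_mat (pcompose p q) X = poly_mat p (poly_mat q X)"
  by (induction p) (simp_all add: pcompose_pCons poly_mat_add poly_mat_mult poly_mat_pCons)

lemma mat_scaleR: "(c *\<^sub>R M) = mat (of_real c) ** M" for M :: "complex^'n^'m"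
  by (simp add: vec_eq_iff mat_matrix_mult) (simp add: scaleR_conv_of_real)

section \<open>The minimal polynomial and the spectrum\<close>

lemma annihilating_poly_exists:
  fixes X :: "complex^'n^'n"
  obtains p where "p \<noteq> 0" "poly_mat p X = 0"
proof -
  \<comment> \<open>The \<open>d + 1\<close> powers with exponents up to \<open>d\<close> lie in a
    real space of dimension \<open>d\<close>, hence satisfy a linear relation.\<close>
  define d where "d = DIM(complex^'n^'n)"
  define f where "f = mat_pow X"
  obtain c where c: "\<exists>i\<le>d. c i \<noteq> (0::real)" "(\<Sum>i\<le>d. c i *\<^sub>R f i) = 0"
  \<comment> \<open>Linear dependence is a property of sets, so two coinciding powers are treated
    apart; they give the relation \<open>f i - f j = 0\<close> directly.\<close>
  proof (cases "inj_on f {..d}")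
    case True
    then have "card (f ` {..d}) > DIM(complex^'n^'n)"
      by (simp add: card_image d_def)
    then have "dependent (f ` {..d})"
      by (intro dependent_biggerset) auto
    then obtain u where u: "\<exists>M\<in>f ` {..d}. u M \<noteq> 0" "(\<Sum>M\<in>f ` {..d}. u M *\<^sub>R M) = 0"
      by (subst (asm) real_vector.dependent_finite) auto
    from u(2) have "(\<Sum>i\<le>d. u (f i) *\<^sub>R f i) = 0"
      by (simp add: sum.reindex[OF True])
    with u(1) show thesis by (intro that[of "\<lambda>i. u (f i)"]) auto
  next
    case False
    then obtain i j where ij: "i \<le> d" "j \<le> d" "i \<noteq> j" "f i = f j"
      by (auto simp: inj_on_def)
    define c where "c = (\<lambda>l. (if l = i then 1 else 0) - (if l = j then 1 else (0::real)))"
    have "(\<Sum>l\<le>d. c l *\<^sub>R f l) = f i - f j"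
      using ij by (simp add: c_def scaleR_left_diff_distrib sum_subtractf
          if_distrib[of "\<lambda>x. x *\<^sub>R _"] cong: if_cong)
    with ij show thesis by (intro that[of c]) (auto simp: c_def)
  qed
  define p where "p = (\<Sum>i\<le>d. monom (of_real (c i) :: complex) i)"
  have "coeff p i = of_real (c i)" if "i \<le> d" for i
    using that by (simp add: p_def coeff_sum)
  with c(1) have "p \<noteq> 0" by auto
  moreover have "poly_mat p X = 0"
    using c(2) by (simp add: p_def poly_mat_sum_poly poly_mat_monom mat_scaleR f_def)
  ultimately show thesis by (rule that)
qed

text \<open>Justifies the definite description. Normalizing an annihilating polynomial of least
  degree gives existence; the difference of two candidates would have smaller degree, which gives
  uniqueness.\<close>

lemma min_poly:
  fixes X :: "complex^'n^'n"
  shows lead_coeff_min_poly: "lead_coeff (min_poly X) = 1"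
    and poly_mat_min_poly: "poly_mat (min_poly X) X = 0"
    and min_poly_minimal: "\<And>q. q \<noteq> 0 \<Longrightarrow> poly_mat q X = 0 \<Longrightarrow> degree (min_poly X) \<le> degree q"
proof -
  let ?P = "\<lambda>p. lead_coeff p = 1 \<and> poly_mat p X = 0 \<and>
     (\<forall>q. q \<noteq> 0 \<and> poly_mat q X = 0 \<longrightarrow> degree p \<le> degree q)"
  obtain p0 where "p0 \<noteq> 0 \<and> poly_mat p0 X = 0"
    using annihilating_poly_exists by blast
  then obtain p where p: "p \<noteq> 0 \<and> poly_mat p X = 0"
    and least: "\<And>q. q \<noteq> 0 \<and> poly_mat q X = 0 \<Longrightarrow> degree p \<le> degree q"
    using ex_has_least_nat[of "\<lambda>p. p \<noteq> 0 \<and> poly_mat p X = 0" p0 degree] by blast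
  have "?P (smult (inverse (lead_coeff p)) p)"
    using p least by (simp add: poly_mat_smult)
  moreover have "a = b" if "?P a" "?P b" for a b
  proof (rule ccontr)
    assume "a \<noteq> b"
    with that have "degree a \<le> degree (a - b)"
      by (simp add: poly_mat_diff)
    moreover have deg: "degree a = degree b"
      using that by (metis antisym degree_0 leading_coeff_0_iff one_neq_zero)
    moreover have "coeff (a - b) (degree a) = 0"
      using that deg by simp
    ultimately have "degree (a - b) = degree a"
      by (intro antisym) (simp_all add: degree_diff_le)
    with \<open>coeff (a - b) (degree a) = 0\<close> \<open>a \<noteq> b\<close> show False
      by (metis eq_iff_diff_eq_0 leading_coeff_0_iff)
  qed
  ultimately have "?P (min_poly X)"
    unfolding min_poly_def by (intro theI[of ?P]) blast
  then show "lead_coeff (min_poly X) = 1" "poly_mat (min_poly X) X = 0"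
    "\<And>q. q \<noteq> 0 \<Longrightarrow> poly_mat q X = 0 \<Longrightarrow> degree (min_poly X) \<le> degree q"
    by blast+
qed

lemma min_poly_nonzero: "min_poly X \<noteq> 0"
  using lead_coeff_min_poly[of X] by auto

lemma poly_mat_root_factor: "poly_mat [:- z, 1:] X = - (mat z - X)"
  by (simp add: poly_mat_pCons mat_add[symmetric]) (simp add: vec_eq_iff mat_def)

lemma invertible_mult_eq_0:
  fixes M :: "'a::field^'n^'n"
  assumes "invertible M" "M ** B = 0"
  shows "B = 0"
  using assms by (metis invertible_def matrix_mul_assoc matrix_mul_lid matrix_mul_rid times0_right)

text \<open>Synthetic division writes \<open>m\<close> as a multiple of the linear factor plus the
  constant \<open>poly m z\<close>; evaluating at \<open>X\<close> kills \<open>m\<close>, so the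
  quotient, rescaled, is the inverse. In particular the inverse is again a polynomial in
  \<open>X\<close>.\<close>

lemma linear_factor_inverse:
  assumes "poly_mat m X = 0" "poly m z \<noteq> 0"
  obtains a where "poly_mat (a * [:- z, 1:]) X = mat 1"
proof
  have "smult (- 1 / poly m z) (synthetic_div m z) * [:- z, 1:]
      = smult (- 1 / poly m z) ([:- z, 1:] * synthetic_div m z)"
    by (metis mult_smult_left mult.commute)
  also have "[:- z, 1:] * synthetic_div m z = m - [:poly m z:]"
    using synthetic_div_correct'[of z m] by (simp only: eq_diff_eq)
  also have "smult (- 1 / poly m z) (m - [:poly m z:]) = smult (- 1 / poly m z) m + 1"
    using assms(2) by (simp add: smult_diff_right one_pCons)
  finally have eq: "smult (- 1 / poly m z) (synthetic_div m z) * [:- z, 1:] = smult (- 1 / poly m z) m + 1" .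
  show "poly_mat (smult (- 1 / poly m z) (synthetic_div m z) * [:- z, 1:]) X = mat 1"
    unfolding eq using assms(1) by (simp add: poly_mat_add poly_mat_diff poly_mat_smult)
qed

text \<open>If the factor of a root were invertible at \<open>X\<close>, cancelling it would
  contradict minimality; off the roots, synthetic division supplies an inverse.\<close>

lemma min_poly_root_iff_spectrum: "poly (min_poly X) z = 0 \<longleftrightarrow> z \<in> spectrum X"
proof
  assume "poly (min_poly X) z = 0"
  then obtain q where q: "min_poly X = [:- z, 1:] * q"
    by (metis dvdE poly_eq_0_iff_dvd)
  then have q0: "q \<noteq> 0" using min_poly_nonzero[of X] by auto
  show "z \<in> spectrum X"
  proof (rule ccontr)
    assume "z \<notin> spectrum X"
    then have inv: "invertible (mat z - X)" by (simp add: spectrum_def)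
    have "poly_mat (- [:- z, 1:] * q) X = 0"
      using poly_mat_min_poly[of X] unfolding q by (simp only: poly_mat_uminus mult_minus_left minus_zero)
    then have "(mat z - X) ** poly_mat q X = 0"
      by (simp only: poly_mat_mult poly_mat_uminus poly_mat_root_factor minus_minus)
    then have "poly_mat q X = 0" using invertible_mult_eq_0 inv by blast
    then have "degree (min_poly X) \<le> degree q" using min_poly_minimal q0 by blast
    moreover have "degree (min_poly X) = Suc (degree q)"
      unfolding q using q0 by (subst degree_mult_eq) auto
    ultimately show False by simp
  qed
next
  assume z: "z \<in> spectrum X"
  show "poly (min_poly X) z = 0"
  proof (rule ccontr)
    assume "poly (min_poly X) z \<noteq> 0"
    then obtain a where "poly_mat (a * [:- z, 1:]) X = mat 1"
      using linear_factor_inverse poly_mat_min_poly by blast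
    then have "poly_mat (- a * - [:- z, 1:]) X = mat 1"
      by (simp only: minus_mult_minus)
    then have "poly_mat (- a) X ** (mat z - X) = mat 1"
      by (simp only: poly_mat_mult poly_mat_uminus poly_mat_root_factor minus_minus)
    with z show False
      by (auto simp: spectrum_def invertible_left_inverse)
  qed
qed

section \<open>Orders of roots and divisibility\<close>

lemma order_ge_if_pderivs_vanish:
  fixes p :: "'a::field_char_0 poly"
  assumes "p \<noteq> 0" "\<And>i. i < n \<Longrightarrow> poly ((pderiv ^^ i) p) z = 0"
  shows "n \<le> order z p"
  using assms
proof (induction n arbitrary: p)
  case (Suc n)
  have "poly p z = 0" using Suc.prems(2)[of 0] by simp
  have nz: "pderiv p \<noteq> 0"
  proof
    assume "pderiv p = 0"
    then obtain c where "p = [:c:]" by (metis pderiv_iszero)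
    with \<open>poly p z = 0\<close> Suc.prems(1) show False by simp
  qed
  have "n \<le> order z (pderiv p)"
    using nz Suc.prems(2)[of "Suc i" for i]
    by (intro Suc.IH) (simp_all add: funpow_Suc_right del: funpow.simps)
  \<comment> \<open>In characteristic zero a derivative lowers the order of a root by exactly
    one.\<close>
  with order_pderiv[OF Suc.prems(1) \<open>poly p z = 0\<close>] show ?case by simp
qed simp

text \<open>Induction on the degree: over the complex numbers \<open>p\<close> has a root,
  \<open>q\<close> shares it, and the common linear factor is cancelled from both.\<close>

lemma dvd_if_order_le:
  fixes p q :: "complex poly"
  assumes "p \<noteq> 0" "q \<noteq> 0" "\<And>z. poly p z = 0 \<Longrightarrow> order z p \<le> order z q"
  shows "p dvd q"
  using assms
proof (induction "degree p" arbitrary: p q)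
  case 0
  then show ?case by (metis dvd_field_iff is_unit_iff_degree unit_imp_dvd)
next
  case (Suc n)
  then obtain z where z: "poly p z = 0"
    by (metis alg_closed_imp_poly_has_root zero_less_Suc)
  then obtain p' where p': "p = [:- z, 1:] * p'" by (metis dvdE poly_eq_0_iff_dvd)
  have "order z q \<noteq> 0"
    using Suc.prems z by (metis le_zero_eq order_root)
  then obtain q' where q': "q = [:- z, 1:] * q'" by (metis dvdE poly_eq_0_iff_dvd order_root)
  have nz: "p' \<noteq> 0" "q' \<noteq> 0" using Suc.prems p' q' by auto
  have ord: "order w p = order w [:- z, 1:] + order w p'" "order w q = order w [:- z, 1:] + order w q'" for w
    unfolding p' q' by (rule order_mult; use Suc.prems p' q' in auto)+
  have "p' dvd q'"
  proof (rule Suc.hyps(1))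
    show "n = degree p'" using Suc.hyps(2) nz unfolding p' by (subst (asm) degree_mult_eq) auto
    show "order w p' \<le> order w q'" if "poly p' w = 0" for w
      using Suc.prems(3)[of w] that ord[of w] by (simp add: p')
  qed (use nz in auto)
  then show ?case unfolding p' q' by (rule mult_dvd_mono[OF dvd_refl])
qed

lemma poly_mat_eq_0_if_min_poly_dvd: "min_poly X dvd p \<Longrightarrow> poly_mat p X = 0"
  by (metis dvdE poly_mat_mult poly_mat_min_poly times0_left)

text \<open>Links the analytic derivatives in the definition of a matrix function with the formal
  ones that govern divisibility.\<close>

lemma deriv_funpow_poly: "(deriv ^^ n) (poly p) = poly ((pderiv ^^ n) p)" for p :: "complex poly"
proof (induction n arbitrary: p)
  case (Suc n)
  have "deriv (poly p) = poly (pderiv p)"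
    by (intro ext DERIV_imp_deriv poly_DERIV)
  with Suc show ?case by (simp add: funpow_Suc_right del: funpow.simps)
qed simp

text \<open>Both \<open>p\<^sup>2\<close> and \<open>f\<^sup>2\<close> have the same derivatives by the Leibniz rule, so \<open>p\<^sup>2 - x\<close> vanishes on the
  spectrum to the order prescribed by the minimal polynomial.\<close>

lemma matrix_sqrt_poly:
  assumes "is_matrix_sqrt Y R"
  obtains p where "R = poly_mat p Y" "R ** R = Y" "\<And>z. z \<in> spectrum Y \<Longrightarrow> poly p z ^ 2 = z"
proof -
  obtain f p where f: "\<And>w. f w ^ 2 = w"
    and an: "\<And>z. z \<in> spectrum Y \<Longrightarrow> order z (min_poly Y) \<ge> 2 \<Longrightarrow> f analytic_on {z}"
    and R: "R = poly_mat p Y"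
    and p: "\<And>z n. z \<in> spectrum Y \<Longrightarrow> n < order z (min_poly Y) \<Longrightarrow>
      poly ((pderiv ^^ n) p) z = (deriv ^^ n) f z"
    using assms unfolding is_matrix_sqrt_def is_matrix_function_def by metis
  define g where "g = p * p - [:0, 1:]"
  \<comment> \<open>Eigenvalues are roots of the minimal polynomial, so the order is positive and
    the interpolation conditions include the value itself.\<close>
  have at_eigenvalue: "poly p z = f z" if "z \<in> spectrum Y" for z
  proof -
    have "order z (min_poly Y) \<noteq> 0"
      using that min_poly_nonzero by (metis min_poly_root_iff_spectrum order_root)
    then show ?thesis using p[OF that, of 0] by simp
  qed
  have deriv_eq: "poly ((pderiv ^^ i) (p * p)) z = poly ((pderiv ^^ i) [:0, 1:]) z"
    if z: "z \<in> spectrum Y" and i: "i < order z (min_poly Y)" for z i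
  \<comment> \<open>Analyticity of \<open>f\<close> is available only at multiple roots; at a simple
    root just the value enters.\<close>
  proof (cases "order z (min_poly Y) \<ge> 2")
    case True
    note anf = an[OF z True]
    have anp: "poly p analytic_on {z}"
      unfolding analytic_at by (intro exI[of _ UNIV])
        (auto simp: holomorphic_on_def field_differentiable_def intro: poly_DERIV has_field_derivative_at_within)
    have "poly ((pderiv ^^ i) (p * p)) z = (deriv ^^ i) (\<lambda>w. poly p w * poly p w) z"
      by (simp add: deriv_funpow_poly[symmetric] poly_mult[abs_def])
    also have "\<dots> = (\<Sum>j = 0..i. of_nat (i choose j) * (deriv ^^ j) (poly p) z * (deriv ^^ (i - j)) (poly p) z)"
      by (rule higher_deriv_mult_at[OF anp anp])
    also have "\<dots> = (\<Sum>j = 0..i. of_nat (i choose j) * (deriv ^^ j) f z * (deriv ^^ (i - j)) f z)"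
      using p[OF z] i by (intro sum.cong refl) (simp add: deriv_funpow_poly)
    also have "\<dots> = (deriv ^^ i) (\<lambda>w. f w * f w) z"
      by (rule higher_deriv_mult_at[OF anf anf, symmetric])
    also have "(\<lambda>w. f w * f w) = poly [:0, 1:]"
      using f by (auto simp: power2_eq_square)
    finally show ?thesis by (simp only: deriv_funpow_poly)
  next
    case False
    with i have "i = 0" by simp
    with at_eigenvalue[OF z] f[of z] show ?thesis by (simp add: power2_eq_square)
  qed
  have "poly_mat g Y = 0"
  proof (cases "g = 0")
    case False
    have "min_poly Y dvd g"
    proof (rule dvd_if_order_le[OF min_poly_nonzero False])
      fix z assume "poly (min_poly Y) z = 0"
      then have z: "z \<in> spectrum Y" by (simp add: min_poly_root_iff_spectrum)
      have "(pderiv ^^ i) g = (pderiv ^^ i) (p * p) - (pderiv ^^ i) [:0, 1:]" for i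
        unfolding g_def by (induction i) (simp_all add: pderiv_diff)
      then show "order z (min_poly Y) \<le> order z g"
        using deriv_eq[OF z] by (intro order_ge_if_pderivs_vanish[OF False]) simp
    qed
    then show ?thesis by (rule poly_mat_eq_0_if_min_poly_dvd)
  qed simp
  then have "R ** R = Y"
    by (simp add: g_def R poly_mat_diff poly_mat_mult)
  moreover have "poly p z ^ 2 = z" if "z \<in> spectrum Y" for z
    using at_eigenvalue[OF that] f[of z] by simp
  ultimately show thesis using R that by blast
qed

lemma poly_mat_commute_of_commute:
  assumes "M ** X = X ** M"
  shows "M ** poly_mat p X = poly_mat p X ** M"
proof (induction p)
  case (pCons a p)
  have "M ** (X ** poly_mat p X) = X ** poly_mat p X ** M"
    by (metis assms matrix_mul_assoc pCons.IH)
  then show ?case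
    by (simp add: poly_mat_pCons matrix_add_ldistrib matrix_add_rdistrib mat_commute)
qed simp

section \<open>The group inverse\<close>

text \<open>Since \<open>x = e *v x + (x - e *v x)\<close>, the vectors fixed by \<open>e\<close>
  and those killed by \<open>e\<close> together span the space. A basis chosen among them forms the
  columns of \<open>S\<close>, and \<open>J\<close> marks the fixed ones.\<close>

lemma idempotent_diagonalizable:
  fixes e :: "'a::field^'n^'n"
  assumes "e ** e = e"
  obtains S :: "'a^'n^'n" and J where "invertible S" "e ** S = S ** (\<chi> i j. if i = j \<and> i \<in> J then 1 else 0)"
proof -
  let ?V = "{x. e *v x = x} \<union> {x. e *v x = 0}"
  obtain B where B: "B \<subseteq> ?V" "vec.independent B" "?V \<subseteq> vec.span B"
    using vec.maximal_independent_subset by blast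
  have "x \<in> vec.span B" for x
  proof -
    have "e *v x \<in> ?V" "x - e *v x \<in> ?V"
      using assms by (auto simp: matrix_vector_mul_assoc matrix_vector_mult_diff_distrib)
    then have "e *v x + (x - e *v x) \<in> vec.span B"
      using B(3) by (intro vec.span_add) blast+
    then show ?thesis by simp
  qed
  then have span: "vec.span B = UNIV" by auto
  have "finite B" using B(2) by (rule vec.finiteI_independent)
  have "card B = vec.dim (UNIV :: ('a^'n) set)"
    using B(2) span by (intro vec.basis_card_eq_dim) auto
  then have "card B = CARD('n)" by (simp only: vec_dim_card)
  then obtain g :: "'n \<Rightarrow> 'a^'n" where g: "bij_betw g UNIV B"
    using \<open>finite B\<close> by (metis finite finite_same_card_bij)
  define S :: "'a^'n^'n" where "S = (\<chi> i j. g j $ i)"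
  define J where "J = {j. e *v g j = g j}"
  have col: "column j S = g j" for j by (simp add: S_def column_def vec_eq_iff)
  have "columns S = B"
    using g by (auto simp: columns_def col bij_betw_def)
  then have "\<exists>S'. S ** S' = mat 1"
    using span by (simp add: matrix_right_invertible_span_columns)
  then have "invertible S" by (simp add: invertible_right_inverse)
  moreover have "e ** S = S ** (\<chi> i j. if i = j \<and> i \<in> J then 1 else 0)" (is "_ = S ** ?D")
  proof -
    have "(e ** S) $ i $ j = (S ** ?D) $ i $ j" for i j
    proof -
      have "g j \<in> ?V" using B(1) g by (auto simp: bij_betw_def)
      then have ker: "e *v g j = 0" if "j \<notin> J" using that by (simp add: J_def)
      have "(e ** S) $ i $ j = (e *v g j) $ i"
        by (simp add: matrix_matrix_mult_def matrix_vector_mult_def S_def)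
      also have "\<dots> = (if j \<in> J then g j $ i else 0)"
        using ker by (auto simp: J_def)
      also have "\<dots> = (S ** ?D) $ i $ j"
        by (simp add: matrix_matrix_mult_def S_def if_distrib[of "\<lambda>x. _ * x"] conj_commute
            cong: if_cong conj_cong)
      finally show ?thesis .
    qed
    then show ?thesis by (simp add: vec_eq_iff)
  qed
  ultimately show thesis by (rule that)
qed

lemma matrix_inv_inverse:
  assumes "invertible M"
  shows "M ** matrix_inv M = mat 1" "matrix_inv M ** M = mat 1"
  using someI_ex[OF assms[unfolded invertible_def]] by (simp_all add: matrix_inv_def)

text \<open>The definition pins down \<open>YG\<close> as soon as some block decomposition of
  \<open>Y\<close> is exhibited. A basis diagonalizing the idempotent \<open>Y ** Z\<close> provides
  one, with \<open>Y\<close> and \<open>Z\<close> becoming mutually inverse blocks.\<close>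

lemma generalized_inverse_eq_group_inverse:
  fixes Y YG Z :: "complex^'n^'n"
  assumes YG: "is_generalized_inverse Y YG"
    and comm: "Y ** Z = Z ** Y" and YZY: "Y ** Z ** Y = Y" and ZYZ: "Z ** Y ** Z = Z"
  shows "YG = Z"
proof -
  define e where "e = Y ** Z"
  have e': "e = Z ** Y" by (simp add: e_def comm)
  have e: "e ** e = e" "e ** Y = Y" "Z ** e = Z"
    by (simp_all only: e_def matrix_mul_assoc YZY ZYZ)
  have e'': "Y ** e = Y" "e ** Z = Z"
    by (simp_all only: e' matrix_mul_assoc YZY ZYZ)
  obtain S :: "complex^'n^'n" and J where S: "invertible S" "e ** S = S ** (\<chi> i j. if i = j \<and> i \<in> J then 1 else 0)"
    using idempotent_diagonalizable[OF e(1)] by blast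
  define \<Delta> :: "complex^'n^'n" where "\<Delta> = (\<chi> i j. if i = j \<and> i \<in> J then 1 else 0)"
  define S' where "S' = matrix_inv S"
  have SS: "S ** S' = mat 1" "S' ** S = mat 1"
    using S(1) by (simp_all add: S'_def matrix_inv_inverse)
  have cancel: "M ** S ** S' = M" "M ** S' ** S = M" for M
    by (simp_all add: SS flip: matrix_mul_assoc)
  have \<Delta>: "\<Delta> = S' ** e ** S"
    using S(2) SS by (simp add: \<Delta>_def flip: matrix_mul_assoc) (simp add: matrix_mul_assoc)
  \<comment> \<open>A matrix that absorbs \<open>e\<close> on both sides is supported on the block
    indexed by \<open>J\<close> in the new basis, because \<open>\<Delta>\<close> is
    \<open>e\<close> in that basis.\<close>
  have outside: "(S' ** M ** S) $ i $ j = 0" if "e ** M = M" "M ** e = M" "\<not> (i \<in> J \<and> j \<in> J)" for M i j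
  proof -
    have "\<Delta> ** (S' ** M ** S) = S' ** M ** S" "(S' ** M ** S) ** \<Delta> = S' ** M ** S"
      unfolding \<Delta> using that by (simp_all add: matrix_mul_assoc cancel) (simp_all flip: matrix_mul_assoc)
    moreover have "(\<Delta> ** L) $ i $ j = (if i \<in> J then L $ i $ j else 0)" for L
      by (cases "i \<in> J") (simp_all add: \<Delta>_def matrix_matrix_mult_def if_distrib[of "\<lambda>x. x * _"] cong: if_cong)
    moreover have "(L ** \<Delta>) $ i $ j = (if j \<in> J then L $ i $ j else 0)" for L
      by (simp add: \<Delta>_def matrix_matrix_mult_def if_distrib[of "\<lambda>x. _ * x"] conj_commute
            cong: if_cong conj_cong)
    ultimately show ?thesis using that(3) by metis
  qed
  have "(S' ** M ** S) ** (S' ** L ** S) = S' ** (M ** L) ** S" for M L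
    by (simp add: matrix_mul_assoc cancel)
  then have "(S' ** Y ** S) ** (S' ** Z ** S) = \<Delta>" "(S' ** Z ** S) ** (S' ** Y ** S) = \<Delta>"
    by (simp_all add: \<Delta> flip: e_def e')
  then have "inverse_block J (S' ** Y ** S) (S' ** Z ** S)"
    unfolding inverse_block_def \<Delta>_def[symmetric] using outside e e'' by blast
  moreover have "S ** (S' ** M ** S) ** S' = M" for M
    by (simp add: matrix_mul_assoc cancel SS)
  ultimately show ?thesis
    using YG S(1) unfolding is_generalized_inverse_def S'_def by metis
qed

text \<open>Congruence modulo the ideal of polynomials annihilating \<open>X\<close>;
  \<open>u\<^sub>1\<close> and \<open>u\<^sub>2\<close> are explicit cofactors, so each application
  reduces to ring arithmetic.\<close>

lemma poly_mat_eqI: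
  assumes "poly_mat e\<^sub>1 X = 0" "poly_mat e\<^sub>2 X = 0" "p - q = e\<^sub>1 * u\<^sub>1 + e\<^sub>2 * u\<^sub>2"
  shows "poly_mat p X = poly_mat q X"
proof -
  have "poly_mat (p - q) X = 0"
    unfolding assms(3) by (simp add: assms(1,2) poly_mat_add poly_mat_mult)
  then show ?thesis by (simp add: poly_mat_diff)
qed

text \<open>In a commutative ring, \<open>r * r * t = r\<close> makes \<open>r * t * t\<close> the
  group inverse of \<open>r\<close>. Here such a \<open>t\<close> is \<open>a * s\<close>, as
  \<open>a\<close> inverts \<open>w\<close> modulo the annihilator of \<open>X\<close>.\<close>

lemma sqrt_group_inverse:
  fixes X :: "complex^'n^'n" and x r s w a :: "complex poly"
  assumes r: "r = x * s" and rr: "poly_mat (r * r) X = poly_mat (x * w) X"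
    and aw: "poly_mat (a * w) X = mat 1"
  obtains t where "poly_mat (r * t * r) X = poly_mat r X"
    "poly_mat (t * r * t) X = poly_mat t X" "poly_mat (t * r * x) X = poly_mat x X"
proof -
  define t where "t = a * s"
  have e1: "poly_mat (r * r - x * w) X = 0" and e2: "poly_mat (a * w - 1) X = 0"
    using rr aw by (simp_all add: poly_mat_diff)
  \<comment> \<open>Modulo the annihilator, \<open>r * r * t\<close> is
    \<open>x * w * a * s\<close>, that is \<open>x * s = r\<close>.\<close>
  have rrt: "poly_mat (r * r * t - r) X = poly_mat 0 X"
    by (rule poly_mat_eqI[OF e1 e2, of _ _ t "s * x"]) (simp add: t_def r algebra_simps)
  then have e3: "poly_mat (r * r * t - r) X = 0" by simp
  have "poly_mat (r * r * r * t * t - r) X = poly_mat 0 X"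
    by (rule poly_mat_eqI[OF e3 e3, of _ _ "r * t" 1]) (simp add: algebra_simps)
  then have e4: "poly_mat (r * r * r * t * t - r) X = 0" by simp
  show thesis
  proof
    show "poly_mat (r * (r * t * t) * r) X = poly_mat r X"
      by (rule poly_mat_eqI[OF e4 e4, of _ _ 1 0]) (simp add: algebra_simps)
    show "poly_mat ((r * t * t) * r * (r * t * t)) X = poly_mat (r * t * t) X"
      by (rule poly_mat_eqI[OF e4 e4, of _ _ "t * t" 0]) (simp add: algebra_simps)
    \<comment> \<open>Since \<open>x\<close> is congruent to \<open>a * r * r\<close>, it is a
      multiple of \<open>r\<close>, so the idempotent belonging to \<open>r\<close> fixes
      it.\<close>
    have "poly_mat (x - a * (r * r)) X = poly_mat 0 X"
      by (rule poly_mat_eqI[OF e1 e2, of _ _ "- a" "- x"]) (simp add: algebra_simps)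
    then have e5: "poly_mat (x - a * (r * r)) X = 0" by simp
    show "poly_mat ((r * t * t) * r * x) X = poly_mat x X"
      by (rule poly_mat_eqI[OF e5 e4, of _ _ "r * r * t * t - 1" "a * r"]) (simp add: algebra_simps)
  qed
qed

section \<open>The discrete Sturm--Liouville problem\<close>

lemma psd_eigenpair_boundary:
  assumes "psd_eigenpair N \<alpha> \<beta> \<mu> v"
  shows "(1 - \<alpha> * real N) * v 0 + \<alpha> * real N * v 1 = 0"
    and "(1 + \<beta> * real N) * v N - \<beta> * real N * v (N - 1) = 0"
  using assms by (simp_all add: psd_eigenpair_def algebra_simps)

lemma psd_eigenpair_step:
  assumes "psd_eigenpair N \<alpha> \<beta> \<mu> v" "0 < i" "i < N"
  shows "v (i + 1) + v (i - 1) - 2 * v i = - \<mu> * v i"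
proof -
  have "v (i + 1) - (2 - \<mu>) * v i + v (i - 1) = 0"
    using assms unfolding psd_eigenpair_def by blast
  then show ?thesis by (simp add: algebra_simps)
qed

lemma psd_eigenpair_step':
  assumes "psd_eigenpair N \<alpha> \<beta> \<mu> v" "Suc n < N"
  shows "v (Suc (Suc n)) = (2 - \<mu>) * v (Suc n) - v n"
  using psd_eigenpair_step[OF assms(1), of "Suc n"] assms(2) by (simp add: algebra_simps)

text \<open>Two pairs annihilated by the same nonzero functional are parallel; used for the
  Wronskian at either end.\<close>

lemma cross_product_zero:
  fixes a b c d p q :: "'a::idom"
  assumes "p * a + q * b = 0" "p * c + q * d = 0" "p \<noteq> 0 \<or> q \<noteq> 0"
  shows "a * d - b * c = 0"
proof -
  have "p * (a * d - b * c) = 0" "q * (a * d - b * c) = 0"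
    using assms(1,2) by algebra+
  with assms(3) show ?thesis by auto
qed

text \<open>The discrete Wronskian of two eigenfunctions vanishes at both ends; its increments are
  \<open>(\<mu> - \<nu>) v w\<close>.\<close>

lemma psd_orthogonal:
  assumes v: "psd_eigenpair N \<alpha> \<beta> \<mu> v" and w: "psd_eigenpair N \<alpha> \<beta> \<nu> w"
    and "\<mu> \<noteq> \<nu>" and N: "N > 0"
  shows "(\<Sum>i\<in>{1..N - 1}. v i * w i) = 0"
proof -
  define W where "W i = v i * w (Suc i) - v (Suc i) * w i" for i
  have "W n = W 0 + (\<mu> - \<nu>) * (\<Sum>i\<in>{1..n}. v i * w i)" if "n < N" for n
    using that
  proof (induction n)
    case (Suc n)
    have "W (Suc n) = W n + (\<mu> - \<nu>) * (v (Suc n) * w (Suc n))"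
      unfolding W_def psd_eigenpair_step'[OF v Suc.prems] psd_eigenpair_step'[OF w Suc.prems]
      by (simp add: algebra_simps)
    with Suc show ?case by (simp add: algebra_simps)
  qed (simp add: W_def)
  from this[of "N - 1"] N have "W (N - 1) = W 0 + (\<mu> - \<nu>) * (\<Sum>i\<in>{1..N - 1}. v i * w i)"
    by simp
  moreover have "W 0 = 0"
  proof -
    \<comment> \<open>The two boundary coefficients add up to \<open>1\<close>, so they cannot both
      vanish.\<close>
    have "1 - \<alpha> * real N \<noteq> 0 \<or> \<alpha> * real N \<noteq> 0" by linarith
    from cross_product_zero[OF psd_eigenpair_boundary(1)[OF v] psd_eigenpair_boundary(1)[OF w] this]
    show ?thesis by (simp add: W_def)
  qed
  moreover have "W (N - 1) = 0"
  proof -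
    have "- (\<beta> * real N) * v (N - 1) + (1 + \<beta> * real N) * v N = 0"
      "- (\<beta> * real N) * w (N - 1) + (1 + \<beta> * real N) * w N = 0"
      using psd_eigenpair_boundary(2)[OF v] psd_eigenpair_boundary(2)[OF w] by simp_all
    from cross_product_zero[OF this] have "v (N - 1) * w N - v N * w (N - 1) = 0"
      by (metis add_0 diff_0 diff_eq_eq neg_equal_0_iff_equal add.right_neutral zero_neq_one)
    with N show ?thesis by (simp add: W_def)
  qed
  ultimately show ?thesis using \<open>\<mu> \<noteq> \<nu>\<close> by simp
qed

text \<open>An eigenfunction vanishing in the interior would serve every \<open>\<mu>\<close>, as the recurrence then does not
  involve \<open>\<mu>\<close>.\<close>

lemma psd_eigenpair_interior_nonzero:
  assumes v: "psd_eigenpair N \<alpha> \<beta> \<mu> v"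
    and fin: "finite {\<mu>. \<exists>w. psd_eigenpair N \<alpha> \<beta> \<mu> w}"
  shows "\<exists>i\<in>{1..N - 1}. v i \<noteq> 0"
proof (rule ccontr)
  assume "\<not> ?thesis"
  then have zero: "v i = 0" if "0 < i" "i < N" for i
    using that by auto
  have "v (i + 1) + v (i - 1) = 0" if "0 < i" "i < N" for i
    using psd_eigenpair_step[OF v that] zero[OF that] by simp
  then have "psd_eigenpair N \<alpha> \<beta> \<nu> v" for \<nu>
    using v zero unfolding psd_eigenpair_def by simp
  then have "{\<mu>. \<exists>w. psd_eigenpair N \<alpha> \<beta> \<mu> w} = UNIV" by blast
  with fin show False by (simp add: infinite_UNIV_char_0)
qed

text \<open>With \<open>p i j = (\<Sum>l. v l i * v l j / n l)\<close> one finds \<open>(\<Sum>i j. (\<delta> i j - p i j)\<^sup>2) = 0\<close>.\<close>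

lemma orthogonal_system_complete:
  fixes v :: "'l \<Rightarrow> 'i \<Rightarrow> real"
  assumes fin: "finite I" "finite L" and card: "card I = card L"
    and orth: "\<And>l m. l \<in> L \<Longrightarrow> m \<in> L \<Longrightarrow> l \<noteq> m \<Longrightarrow> (\<Sum>i\<in>I. v l i * v m i) = 0"
    and nz: "\<And>l. l \<in> L \<Longrightarrow> (\<Sum>i\<in>I. (v l i)\<^sup>2) \<noteq> 0"
    and ij: "i \<in> I" "j \<in> I"
  shows "(\<Sum>l\<in>L. v l i * v l j / (\<Sum>i\<in>I. (v l i)\<^sup>2)) = (if i = j then 1 else 0)"
proof -
  define n where "n l = (\<Sum>i\<in>I. (v l i)\<^sup>2)" for l
  define p where "p i j = (\<Sum>l\<in>L. v l i * v l j / n l)" for i j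
  define \<delta> where "\<delta> i j = (if i = j then 1 else 0 :: real)" for i j :: 'i
  have inner: "(\<Sum>i\<in>I. v l i * v m i) = (if l = m then n l else 0)" if "l \<in> L" "m \<in> L" for l m
    using orth that by (simp add: n_def power2_eq_square)
  \<comment> \<open>The three double sums are the squared norm of the identity, the trace of
    \<open>p\<close> and the squared norm of \<open>p\<close>; expanding the square makes them
    cancel.\<close>
  have "(\<Sum>i\<in>I. \<Sum>j\<in>I. \<delta> i j * \<delta> i j) = card I"
    using fin by (simp add: \<delta>_def if_distrib[of "\<lambda>x. _ * x"] cong: if_cong)
  moreover have "(\<Sum>i\<in>I. \<Sum>j\<in>I. \<delta> i j * p i j) = card I"
  proof -
    have "(\<Sum>i\<in>I. \<Sum>j\<in>I. \<delta> i j * p i j) = (\<Sum>i\<in>I. p i i)"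
      using fin by (simp add: \<delta>_def if_distrib[of "\<lambda>x. x * _"] cong: if_cong)
    also have "\<dots> = (\<Sum>l\<in>L. \<Sum>i\<in>I. v l i * v l i / n l)"
      unfolding p_def by (rule sum.swap)
    also have "\<dots> = (\<Sum>l\<in>L. 1)"
      using inner nz by (intro sum.cong refl) (simp add: n_def flip: sum_divide_distrib)
    finally show ?thesis by (simp add: card)
  qed
  moreover have "(\<Sum>i\<in>I. \<Sum>j\<in>I. p i j * p i j) = card I"
  proof -
    have "(\<Sum>i\<in>I. \<Sum>j\<in>I. p i j * p i j)
        = (\<Sum>i\<in>I. \<Sum>j\<in>I. \<Sum>l\<in>L. \<Sum>m\<in>L. (v l i * v m i) * (v l j * v m j) / (n l * n m))"
      unfolding p_def sum_product by (simp add: mult_ac)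
    also have "\<dots> = (\<Sum>l\<in>L. \<Sum>m\<in>L. \<Sum>i\<in>I. \<Sum>j\<in>I. (v l i * v m i) * (v l j * v m j) / (n l * n m))"
      by (simp only: sum.swap[of _ L I])
    also have "\<dots> = (\<Sum>l\<in>L. \<Sum>m\<in>L. (\<Sum>i\<in>I. v l i * v m i) * (\<Sum>j\<in>I. v l j * v m j) / (n l * n m))"
      by (simp only: sum_product sum_divide_distrib)
    also have "\<dots> = (\<Sum>l\<in>L. \<Sum>m\<in>L. if l = m then 1 else 0)"
      using nz by (intro sum.cong refl) (simp add: inner n_def)
    also have "\<dots> = card L" using fin by simp
    finally show ?thesis by (simp add: card)
  qed
  moreover have "(\<Sum>i\<in>I. \<Sum>j\<in>I. (\<delta> i j - p i j)\<^sup>2)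
      = (\<Sum>i\<in>I. \<Sum>j\<in>I. \<delta> i j * \<delta> i j) - 2 * (\<Sum>i\<in>I. \<Sum>j\<in>I. \<delta> i j * p i j)
        + (\<Sum>i\<in>I. \<Sum>j\<in>I. p i j * p i j)"
  proof -
    have "(\<delta> i j - p i j)\<^sup>2 = \<delta> i j * \<delta> i j - 2 * (\<delta> i j * p i j) + p i j * p i j" for i j
      by (simp add: power2_eq_square algebra_simps)
    then show ?thesis by (simp only: sum.distrib sum_subtractf sum_distrib_left)
  qed
  ultimately have "(\<Sum>i\<in>I. \<Sum>j\<in>I. (\<delta> i j - p i j)\<^sup>2) = 0" by simp
  then have "\<delta> i j - p i j = 0"
    using fin ij by (simp add: sum_nonneg_eq_0_iff sum_nonneg)
  then show ?thesis by (simp add: p_def n_def \<delta>_def)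
qed

text \<open>The completeness relation is weighted with the values \<open>f j\<close> and summed; the
  coefficients are real, so vector values cause no difficulty.\<close>

lemma orthogonal_system_expansion:
  fixes v :: "'l \<Rightarrow> 'i \<Rightarrow> real" and f :: "'i \<Rightarrow> 'a::real_vector"
  assumes fin: "finite I" "finite L" and card: "card I = card L"
    and orth: "\<And>l m. l \<in> L \<Longrightarrow> m \<in> L \<Longrightarrow> l \<noteq> m \<Longrightarrow> (\<Sum>i\<in>I. v l i * v m i) = 0"
    and nz: "\<And>l. l \<in> L \<Longrightarrow> (\<Sum>i\<in>I. (v l i)\<^sup>2) \<noteq> 0"
    and i: "i \<in> I"
  shows "(\<Sum>l\<in>L. v l i *\<^sub>R ((\<Sum>j\<in>I. v l j *\<^sub>R f j) /\<^sub>R (\<Sum>j\<in>I. (v l j)\<^sup>2))) = f i"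
proof -
  have "(\<Sum>l\<in>L. v l i *\<^sub>R ((\<Sum>j\<in>I. v l j *\<^sub>R f j) /\<^sub>R (\<Sum>j\<in>I. (v l j)\<^sup>2)))
      = (\<Sum>l\<in>L. \<Sum>j\<in>I. (v l i * v l j / (\<Sum>j\<in>I. (v l j)\<^sup>2)) *\<^sub>R f j)"
    by (simp add: scaleR_sum_right divide_inverse mult_ac)
  also have "\<dots> = (\<Sum>j\<in>I. (\<Sum>l\<in>L. v l i * v l j / (\<Sum>j\<in>I. (v l j)\<^sup>2)) *\<^sub>R f j)"
    unfolding scaleR_sum_left by (rule sum.swap)
  also have "\<dots> = (\<Sum>j\<in>I. (if i = j then 1 else 0) *\<^sub>R f j)"
    by (intro sum.cong refl arg_cong2[of _ _ _ _ scaleR] orthogonal_system_complete)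
      (use assms in auto)
  also have "\<dots> = f i"
    using fin i by (simp add: if_distrib[of "\<lambda>x. x *\<^sub>R _"] cong: if_cong)
  finally show ?thesis .
qed

text \<open>Cramer's rule with vector unknowns. It serves the mesh \<open>N = 1\<close>, where the
  two end values are coupled to each other.\<close>

lemma det_zero_solution:
  fixes x y :: "'a::real_vector" and a b c d :: real
  assumes "a *\<^sub>R x + b *\<^sub>R y = 0" "c *\<^sub>R x + d *\<^sub>R y = 0" "a * d - b * c \<noteq> 0"
  shows "x = 0" "y = 0"
proof -
  have eq: "d *\<^sub>R (a *\<^sub>R x + b *\<^sub>R y) - b *\<^sub>R (c *\<^sub>R x + d *\<^sub>R y) = (a * d - b * c) *\<^sub>R x"
    "a *\<^sub>R (c *\<^sub>R x + d *\<^sub>R y) - c *\<^sub>R (a *\<^sub>R x + b *\<^sub>R y) = (a * d - b * c) *\<^sub>R y"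
    by (simp_all add: algebra_simps)
  show "x = 0" "y = 0"
    using eq assms(3) unfolding assms(1,2) by simp_all
qed

text \<open>Completeness excludes \<open>\<alpha> N = 1\<close> and \<open>\<beta> N = -1\<close>, where all eigenfunctions would vanish at \<open>1\<close>
  or at \<open>N - 1\<close>, so the boundary conditions determine the values at \<open>0\<close> and \<open>N\<close>.\<close>

lemma psd_expansion:
  fixes f :: "nat \<Rightarrow> 'a::real_vector"
  assumes N: "N > 0"
    and eigenfunctions: "\<And>l. l \<in> {0<..<N} \<Longrightarrow> psd_eigenpair N \<alpha> \<beta> (lam l) (v l)"
    and eigenvalues: "bij_betw lam {0<..<N} {\<mu>. \<exists>w. psd_eigenpair N \<alpha> \<beta> \<mu> w}"
    and edge: "f 0 + (\<alpha> * real N) *\<^sub>R (f 1 - f 0) = 0"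
      "f N + (\<beta> * real N) *\<^sub>R (f N - f (N - 1)) = 0"
    and i: "i \<le> N"
  shows "(\<Sum>l\<in>{1..N - 1}. v l i *\<^sub>R
      ((\<Sum>j\<in>{1..N - 1}. v l j *\<^sub>R f j) /\<^sub>R (\<Sum>j\<in>{1..N - 1}. (v l j)\<^sup>2))) = f i"
proof -
  let ?I = "{1..N - 1}"
  have mem: "l \<in> {0<..<N}" if "l \<in> ?I" for l using that by auto
  have fin: "finite {\<mu>. \<exists>w. psd_eigenpair N \<alpha> \<beta> \<mu> w}"
    using eigenvalues bij_betw_finite by blast
  have nz: "(\<Sum>j\<in>?I. (v l j)\<^sup>2) \<noteq> 0" if "l \<in> ?I" for l
    using psd_eigenpair_interior_nonzero[OF eigenfunctions[OF mem[OF that]] fin]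
    by (subst sum_nonneg_eq_0_iff) auto
  have orth: "(\<Sum>j\<in>?I. v l j * v m j) = 0" if "l \<in> ?I" "m \<in> ?I" "l \<noteq> m" for l m
  proof -
    have "lam l \<noteq> lam m"
      using eigenvalues mem that by (metis bij_betw_imp_inj_on inj_onD)
    then show ?thesis using psd_orthogonal eigenfunctions mem that N by blast
  qed
  define c where "c l = (\<Sum>j\<in>?I. v l j *\<^sub>R f j) /\<^sub>R (\<Sum>j\<in>?I. (v l j)\<^sup>2)" for l
  \<comment> \<open>The defect of the expansion: it vanishes in the interior and obeys the
    homogeneous scalar boundary conditions.\<close>
  define d where "d i = f i - (\<Sum>l\<in>?I. v l i *\<^sub>R c l)" for i
  have d_interior: "d j = 0" if "j \<in> ?I" for j
    using orthogonal_system_expansion[where f = f, OF _ _ refl orth nz that] by (simp add: d_def c_def)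
  have complete: "(\<Sum>l\<in>?I. v l j * v l j / (\<Sum>i\<in>?I. (v l i)\<^sup>2)) = 1" if "j \<in> ?I" for j
    using orthogonal_system_complete[OF _ _ refl orth nz that that] by simp
  have edge0: "(1 - \<alpha> * real N) *\<^sub>R d 0 + (\<alpha> * real N) *\<^sub>R d 1 = 0"
  proof -
    have "(1 - \<alpha> * real N) *\<^sub>R d 0 + (\<alpha> * real N) *\<^sub>R d 1
        = (f 0 + (\<alpha> * real N) *\<^sub>R (f 1 - f 0))
          - (\<Sum>l\<in>?I. ((1 - \<alpha> * real N) * v l 0 + \<alpha> * real N * v l 1) *\<^sub>R c l)"
      unfolding d_def by (simp add: algebra_simps scaleR_sum_right sum.distrib sum_subtractf sum_negf)
    also have "(\<Sum>l\<in>?I. ((1 - \<alpha> * real N) * v l 0 + \<alpha> * real N * v l 1) *\<^sub>R c l) = 0"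
      using psd_eigenpair_boundary(1)[OF eigenfunctions[OF mem]] by (intro sum.neutral ballI) simp
    finally show ?thesis using edge(1) by simp
  qed
  have edgeN: "- (\<beta> * real N) *\<^sub>R d (N - 1) + (1 + \<beta> * real N) *\<^sub>R d N = 0"
  proof -
    have "- (\<beta> * real N) *\<^sub>R d (N - 1) + (1 + \<beta> * real N) *\<^sub>R d N
        = (f N + (\<beta> * real N) *\<^sub>R (f N - f (N - 1)))
          - (\<Sum>l\<in>?I. ((1 + \<beta> * real N) * v l N - \<beta> * real N * v l (N - 1)) *\<^sub>R c l)"
      unfolding d_def by (simp add: algebra_simps scaleR_sum_right sum.distrib sum_subtractf sum_negf)
    also have "(\<Sum>l\<in>?I. ((1 + \<beta> * real N) * v l N - \<beta> * real N * v l (N - 1)) *\<^sub>R c l) = 0"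
      using psd_eigenpair_boundary(2)[OF eigenfunctions[OF mem]] by (intro sum.neutral ballI) simp
    finally show ?thesis using edge(2) by simp
  qed
  have "d 0 = 0 \<and> d N = 0"
  proof (cases "N = 1")
    case True
    have "(1 - \<alpha>) * (1 + \<beta>) - \<alpha> * (- \<beta>) \<noteq> 0"
    proof
      assume det: "(1 - \<alpha>) * (1 + \<beta>) - \<alpha> * (- \<beta>) = 0"
      have "\<exists>i\<le>1. (if i = (0::nat) then \<alpha> else \<alpha> - 1) \<noteq> 0"
      proof (cases "\<alpha> = 0")
        assume "\<alpha> = 0"
        then show ?thesis by (intro exI[of _ 1]) simp
      next
        assume "\<alpha> \<noteq> 0"
        then show ?thesis by (intro exI[of _ 0]) simp
      qed
      \<comment> \<open>For \<open>N = 1\<close> there is no interior equation, so a vanishing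
        determinant yields an eigenfunction with end values \<open>\<alpha>\<close> and
        \<open>\<alpha> - 1\<close>, although the set of eigenvalues is empty.\<close>
      then have "psd_eigenpair N \<alpha> \<beta> 0 (\<lambda>i. if i = 0 then \<alpha> else \<alpha> - 1)"
        using det unfolding psd_eigenpair_def True by (auto simp: algebra_simps)
      moreover have "{\<mu>. \<exists>w. psd_eigenpair N \<alpha> \<beta> \<mu> w} = {}"
        using eigenvalues True by (auto simp: bij_betw_def)
      ultimately show False by blast
    qed
    then show ?thesis
      using det_zero_solution[of "1 - \<alpha>" "d 0" \<alpha> "d N" "- \<beta>" "1 + \<beta>"] edge0 edgeN True by simp
  next
    case False
    with N have ends: "1 \<in> ?I" "N - 1 \<in> ?I" by auto
    have "1 - \<alpha> * real N \<noteq> 0"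
    proof
      assume "1 - \<alpha> * real N = 0"
      then have "v l 1 = 0" if "l \<in> ?I" for l
        using psd_eigenpair_boundary(1)[OF eigenfunctions[OF mem[OF that]]] by auto
      with complete[OF ends(1)] show False by simp
    qed
    moreover have "1 + \<beta> * real N \<noteq> 0"
    proof
      assume "1 + \<beta> * real N = 0"
      then have "v l (N - 1) = 0" if "l \<in> ?I" for l
        using psd_eigenpair_boundary(2)[OF eigenfunctions[OF mem[OF that]]] by auto
      with complete[OF ends(2)] show False by simp
    qed
    ultimately show ?thesis using edge0 edgeN d_interior ends by simp
  qed
  then have "d i = 0" using d_interior[of i] i by (cases "i = 0 \<or> i = N") auto
  then show ?thesis by (simp add: d_def c_def)
qed

section \<open>Evolution of a single mode\<close>

lemma matrix_diff_rdistrib: "(A - B) ** C = A ** C - B ** C" for A B :: "'a::ring_1^'n^'m"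
  by (simp add: vec_eq_iff matrix_matrix_mult_def left_diff_distrib sum_subtractf)

lemma scaleR_matrix_vector_mult: "(c *\<^sub>R M) *v u = c *\<^sub>R (M *v u)"
  for M :: "'a::real_algebra_1^'n^'m"
  by (simp add: vec_eq_iff matrix_vector_mult_def scaleR_sum_right)

text \<open>The trailing \<open>\<Phi>\<close> covers the exponent \<open>0\<close>, where the power
  is the full identity and not \<open>\<Phi>\<close>.\<close>

lemma mat_pow_poly_mat_idempotent:
  assumes "\<Phi> ** \<Phi> = \<Phi>" "\<Phi> ** X = X ** \<Phi>"
  shows "mat_pow (poly_mat p X ** \<Phi>) j ** \<Phi> = poly_mat (p ^ j) X ** \<Phi>"
proof (induction j)
  case (Suc j)
  have "poly_mat p X ** \<Phi> ** (poly_mat (p ^ j) X ** \<Phi>) = poly_mat p X ** (\<Phi> ** poly_mat (p ^ j) X) ** \<Phi>"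
    by (simp only: matrix_mul_assoc)
  also have "\<dots> = poly_mat p X ** poly_mat (p ^ j) X ** (\<Phi> ** \<Phi>)"
    by (simp only: poly_mat_commute_of_commute[OF assms(2)] matrix_mul_assoc)
  finally show ?case using Suc by (simp add: poly_mat_mult assms(1) flip: matrix_mul_assoc)
qed simp

text \<open>Modulo the annihilator of \<open>X\<close>, both \<open>p\<close> and \<open>q\<close>
  solve the characteristic equation, so their powers satisfy the recurrence. Applying
  \<open>YG\<close> solves the system for the initial values, since \<open>f\<close> and
  \<open>g\<close> lie in the range of \<open>X\<close>. Here \<open>g\<close> stands for the
  increment over the first time step.\<close>

lemma mode_solution:
  fixes X \<Phi> YG Z\<^sub>0 Z\<^sub>1 :: "complex^'n^'n" and f g :: "complex^'n"
  assumes \<Phi>: "\<Phi> ** \<Phi> = \<Phi>" "\<Phi> ** X = X" "X ** \<Phi> = X"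
    and singular: "\<not> invertible X"
    and \<rho>: "\<rho> \<noteq> 0"
    and nonresonant: "\<And>d. d \<in> spectrum X - {0} \<Longrightarrow> 1 + of_real \<rho> / 4 * d \<noteq> 0"
    and pq: "P_pair X \<rho> p q"
    and Z\<^sub>0: "Z\<^sub>0 = poly_mat p X ** \<Phi>" and Z\<^sub>1: "Z\<^sub>1 = poly_mat q X ** \<Phi>"
    and YG: "is_generalized_inverse ((Z\<^sub>1 - Z\<^sub>0) ** \<Phi>) YG"
    and fg: "f \<in> range ((*v) X)" "g \<in> range ((*v) X)"
  defines "c \<equiv> \<lambda>j. (mat_pow Z\<^sub>0 j ** \<Phi>) *v (YG *v ((Z\<^sub>1 - mat 1) *v f - g))
    + (mat_pow Z\<^sub>1 j ** \<Phi>) *v (YG *v (g - (Z\<^sub>0 - mat 1) *v f))"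
  shows "c 0 = f" "c 1 = f + g"
    "c (Suc (Suc j)) = 2 *\<^sub>R c (Suc j) - c j + \<rho> *\<^sub>R (X *v c (Suc j))"
proof -
  \<comment> \<open>Chosen so that \<open>b * b - 1 = x * w\<close>: the radicand splits into
    \<open>X\<close> and a factor that turns out to be invertible.\<close>
  define x b w h :: "complex poly" where "x = [:0, 1:]" and "b = [:1, of_real \<rho> / 2:]"
    and "w = [:of_real \<rho>, (of_real \<rho>)\<^sup>2 / 4:]" and "h = [:1 / 2:]"
  have x: "poly_mat x X = X" by (simp add: x_def)
  have b: "poly_mat b X = mat 1 + (\<rho> / 2) *\<^sub>R X"
    unfolding mat_scaleR by (simp add: b_def poly_mat_pCons mat_commute)
  have bb: "b * b - 1 = x * w"
    by (simp add: b_def x_def w_def one_pCons power2_eq_square)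
  have "mat_pow (mat 1 + (\<rho> / 2) *\<^sub>R X) 2 - mat 1 = poly_mat (x * w) X"
    by (simp add: numeral_2_eq_2 poly_mat_diff poly_mat_mult flip: bb b)
  with pq obtain R where R: "is_matrix_sqrt (poly_mat (x * w) X) R"
    and p: "poly_mat p X = poly_mat b X + R" and q: "poly_mat q X = poly_mat b X - R"
    unfolding P_pair_def b by metis
  obtain p\<^sub>0 where p\<^sub>0: "R = poly_mat p\<^sub>0 (poly_mat (x * w) X)" "R ** R = poly_mat (x * w) X"
    "\<And>z. z \<in> spectrum (poly_mat (x * w) X) \<Longrightarrow> (poly p\<^sub>0 z)\<^sup>2 = z"
    using matrix_sqrt_poly[OF R] by blast
  \<comment> \<open>Singularity of \<open>X\<close> makes \<open>0\<close> an eigenvalue of the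
    radicand, which forces \<open>p\<^sub>0\<close> to vanish at \<open>0\<close> and hence to be
    divisible by \<open>x\<close>.\<close>
  have "0 \<in> spectrum (poly_mat (x * w) X)"
  proof -
    have eq: "mat 0 - poly_mat (x * w) X = X ** poly_mat (- w) X"
      using poly_mat_mult[of x "- w" X] by (simp add: x poly_mat_uminus)
    have "\<not> invertible (X ** poly_mat (- w) X)"
      using singular unfolding invertible_right_inverse by (metis matrix_mul_assoc)
    then show ?thesis unfolding spectrum_def mem_Collect_eq eq .
  qed
  with p\<^sub>0(3) have "poly p\<^sub>0 0 = 0" by fastforce
  then obtain s\<^sub>0 where s\<^sub>0: "p\<^sub>0 = x * s\<^sub>0"
    by (metis dvdE minus_zero poly_eq_0_iff_dvd x_def)
  define s where "s = w * pcompose s\<^sub>0 (x * w)"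
  define r where "r = x * s"
  have "pcompose p\<^sub>0 (x * w) = r"
    unfolding s\<^sub>0 r_def s_def pcompose_mult by (simp add: x_def pcompose_pCons)
  then have r: "R = poly_mat r X" using p\<^sub>0(1) by (metis poly_mat_pcompose)
  have rr: "poly_mat (r * r) X = poly_mat (x * w) X"
    using p\<^sub>0(2) by (simp add: poly_mat_mult r)
  \<comment> \<open>The only root of \<open>w\<close>; the nonresonance condition keeps it out of
    the spectrum, so \<open>w\<close> is invertible at \<open>X\<close>.\<close>
  define z :: complex where "z = - 4 / of_real \<rho>"
  have "z \<notin> spectrum X" using nonresonant[of z] \<rho> by (auto simp: z_def)
  then obtain a\<^sub>0 where a\<^sub>0: "poly_mat (a\<^sub>0 * [:- z, 1:]) X = mat 1"
    using linear_factor_inverse[OF poly_mat_min_poly, of X z] by (auto simp: min_poly_root_iff_spectrum)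
  define a where "a = smult (4 / (of_real \<rho>)\<^sup>2) a\<^sub>0"
  have "w = smult ((of_real \<rho>)\<^sup>2 / 4) [:- z, 1:]"
    using \<rho> by (simp add: w_def z_def power2_eq_square)
  then have "a * w = a\<^sub>0 * [:- z, 1:]"
    using \<rho> by (simp only: a_def mult_smult_left mult_smult_right smult_smult) simp
  then have aw: "poly_mat (a * w) X = mat 1" using a\<^sub>0 by simp
  obtain t where t: "poly_mat (r * t * r) X = poly_mat r X"
    "poly_mat (t * r * t) X = poly_mat t X" "poly_mat (t * r * x) X = poly_mat x X"
    using sqrt_group_inverse[OF r_def rr aw] by blast
  \<comment> \<open>As \<open>Z\<^sub>1 - Z\<^sub>0\<close> acts as \<open>- 2 R\<close> and
    \<open>t\<close> gives the group inverse of \<open>R\<close>, the group inverse sought is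
    \<open>- t / 2\<close>.\<close>
  define y where "y = - (h * t)"
  have hh: "h + h = 1" by (simp add: h_def one_pCons)
  have diff_qp: "poly_mat q X - poly_mat p X = poly_mat (- (r + r)) X"
    by (simp only: p q r poly_mat_uminus poly_mat_add) simp
  have r\<Phi>: "poly_mat (- (r + r)) X ** \<Phi> = poly_mat (- (r + r)) X"
  proof -
    have eq: "- (r + r) = - (s + s) * x" by (simp add: r_def algebra_simps)
    show ?thesis unfolding eq poly_mat_mult x by (simp add: \<Phi>(3) flip: matrix_mul_assoc)
  qed
  have Y: "(Z\<^sub>1 - Z\<^sub>0) ** \<Phi> = poly_mat (- (r + r)) X"
    unfolding Z\<^sub>0 Z\<^sub>1 matrix_diff_rdistrib[symmetric] diff_qp by (simp only: r\<Phi>)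
  have YG_eq: "YG = poly_mat y X"
  proof (rule generalized_inverse_eq_group_inverse[OF YG])
    have eq: "- (r + r) * y * - (r + r) = - ((h + h) * (r * t * r + r * t * r))"
      by (simp add: y_def algebra_simps)
    then have "poly_mat (- (r + r) * y * - (r + r)) X = poly_mat (- (r + r)) X"
      unfolding eq hh by (simp only: mult_1_left poly_mat_uminus poly_mat_add t)
    then show "(Z\<^sub>1 - Z\<^sub>0) ** \<Phi> ** poly_mat y X ** ((Z\<^sub>1 - Z\<^sub>0) ** \<Phi>) = (Z\<^sub>1 - Z\<^sub>0) ** \<Phi>"
      unfolding Y poly_mat_mult .
    have eq: "y * - (r + r) * y = - ((h + h) * h * (t * r * t))"
      by (simp add: y_def algebra_simps)
    then have "poly_mat (y * - (r + r) * y) X = poly_mat y X"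
      unfolding eq hh y_def by (simp only: mult_1_left poly_mat_uminus poly_mat_mult[of h] t)
    then show "poly_mat y X ** ((Z\<^sub>1 - Z\<^sub>0) ** \<Phi>) ** poly_mat y X = poly_mat y X"
      unfolding Y poly_mat_mult .
    show "(Z\<^sub>1 - Z\<^sub>0) ** \<Phi> ** poly_mat y X = poly_mat y X ** ((Z\<^sub>1 - Z\<^sub>0) ** \<Phi>)"
      unfolding Y by (rule poly_mat_commute)
  qed
  have inv: "poly_mat y X *v (poly_mat (- (r + r)) X *v (X *v u)) = X *v u" for u
  proof -
    have eq: "y * (- (r + r) * x) = (h + h) * (t * r * x)" by (simp add: y_def algebra_simps)
    then have "poly_mat (y * (- (r + r) * x)) X = X" unfolding eq hh by (simp only: mult_1_left t x)
    then show ?thesis by (simp only: matrix_vector_mul_assoc matrix_mul_assoc poly_mat_mult x)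
  qed
  have comm: "poly_mat p' X *v (poly_mat q' X *v u) = poly_mat q' X *v (poly_mat p' X *v u)" for p' q' u
    by (simp only: matrix_vector_mul_assoc poly_mat_commute)
  obtain f\<^sub>0 g\<^sub>0 where f\<^sub>0: "f = X *v f\<^sub>0" and g\<^sub>0: "g = X *v g\<^sub>0" using fg by blast
  have Zf: "Z\<^sub>0 *v f = poly_mat p X *v f" "Z\<^sub>1 *v f = poly_mat q X *v f"
    unfolding Z\<^sub>0 Z\<^sub>1 f\<^sub>0 by (simp_all add: matrix_vector_mul_assoc \<Phi>(2) flip: matrix_mul_assoc)
  define A where "A = poly_mat q X *v f - f - g"
  define B where "B = g - (poly_mat p X *v f - f)"
  have \<Phi>_drop: "\<Phi> *v (poly_mat y X *v u) = poly_mat y X *v u" if "\<Phi> *v u = u" for u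
    using that poly_mat_commute_of_commute[of \<Phi> X y] \<Phi> by (metis matrix_vector_mul_assoc)
  have \<Phi>fg: "\<Phi> *v f = f" "\<Phi> *v g = g"
    by (simp_all add: f\<^sub>0 g\<^sub>0 matrix_vector_mul_assoc \<Phi>)
  have \<Phi>_poly: "\<Phi> *v (poly_mat p' X *v f) = poly_mat p' X *v f" for p'
    using \<Phi>fg(1) poly_mat_commute_of_commute[of \<Phi> X p'] \<Phi> by (metis matrix_vector_mul_assoc)
  have \<Phi>AB: "\<Phi> *v A = A" "\<Phi> *v B = B"
    by (simp_all add: A_def B_def matrix_vector_mult_diff_distrib \<Phi>_poly \<Phi>fg)
  have c: "c j = poly_mat (p ^ j) X *v (poly_mat y X *v A) + poly_mat (q ^ j) X *v (poly_mat y X *v B)" for j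
  proof -
    have "c j = (poly_mat (p ^ j) X ** \<Phi>) *v (poly_mat y X *v A) + (poly_mat (q ^ j) X ** \<Phi>) *v (poly_mat y X *v B)"
      unfolding c_def YG_eq A_def B_def matrix_vector_mult_diff_rdistrib Zf matrix_vector_mul_lid
      unfolding Z\<^sub>0 Z\<^sub>1 using mat_pow_poly_mat_idempotent[of \<Phi> X] \<Phi> by simp
    then show ?thesis by (simp add: \<Phi>_drop \<Phi>AB flip: matrix_vector_mul_assoc)
  qed
  show "c 0 = f"
  proof -
    have "c 0 = poly_mat y X *v (A + B)" by (simp add: c matrix_vector_right_distrib)
    also have "A + B = (poly_mat q X - poly_mat p X) *v f"
      by (simp add: A_def B_def matrix_vector_mult_diff_rdistrib)
    finally show ?thesis by (simp only: diff_qp f\<^sub>0 inv)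
  qed
  show "c 1 = f + g"
  proof -
    have "c 1 = poly_mat y X *v (poly_mat p X *v A + poly_mat q X *v B)"
      unfolding c power_one_right by (simp only: comm[of _ y] matrix_vector_right_distrib)
    \<comment> \<open>The terms with \<open>p\<close> and \<open>q\<close> both applied to
      \<open>f\<close> cancel because the two matrices commute.\<close>
    also have "poly_mat p X *v A + poly_mat q X *v B = (poly_mat q X - poly_mat p X) *v (f + g)"
      by (simp add: A_def B_def algebra_simps comm[of p q])
    also have "f + g = X *v (f\<^sub>0 + g\<^sub>0)"
      by (simp add: f\<^sub>0 g\<^sub>0 matrix_vector_right_distrib)
    finally show ?thesis by (simp only: diff_qp inv f\<^sub>0 g\<^sub>0 matrix_vector_right_distrib)
  qed
  have power_step: "poly_mat (p' ^ Suc (Suc j)) X *v u = 2 *\<^sub>R (poly_mat (p' ^ Suc j) X *v u)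
      - poly_mat (p' ^ j) X *v u + \<rho> *\<^sub>R (X *v (poly_mat (p' ^ Suc j) X *v u))"
    if "poly_mat (p' * p' - (b + b) * p' + 1) X = 0" for p' u
  proof -
    have "p' ^ Suc (Suc j) = (p' * p' - (b + b) * p' + 1) * p' ^ j + (b + b) * p' ^ Suc j - p' ^ j"
      by (simp add: algebra_simps)
    then have "poly_mat (p' ^ Suc (Suc j)) X = poly_mat (b + b) X ** poly_mat (p' ^ Suc j) X - poly_mat (p' ^ j) X"
      by (simp only: poly_mat_add[of "_ * _"] poly_mat_diff[of "_ + _"] poly_mat_mult[of _ "p' ^ _"] that) simp
    moreover have "poly_mat (b + b) X *v u' = 2 *\<^sub>R u' + \<rho> *\<^sub>R (X *v u')" for u'
    proof -
      have "poly_mat (b + b) X *v u' = u' + u' + ((\<rho> / 2) *\<^sub>R (X *v u') + (\<rho> / 2) *\<^sub>R (X *v u'))"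
        unfolding poly_mat_add b matrix_vector_mult_add_rdistrib scaleR_matrix_vector_mult by simp
      also have "(\<rho> / 2) *\<^sub>R (X *v u') + (\<rho> / 2) *\<^sub>R (X *v u') = \<rho> *\<^sub>R (X *v u')"
        unfolding scaleR_left_distrib[symmetric] by simp
      finally show ?thesis unfolding scaleR_2 .
    qed
    ultimately show ?thesis
      by (simp add: matrix_vector_mult_diff_rdistrib flip: matrix_vector_mul_assoc)
  qed
  \<comment> \<open>With \<open>p' = b + e\<close> and \<open>e * e = b * b - 1\<close> the
    quadratic vanishes; it is used for \<open>e = r\<close> and \<open>e = - r\<close>.\<close>
  have char: "poly_mat (p' * p' - (b + b) * p' + 1) X = 0"
    if "poly_mat p' X = poly_mat (b + e) X" "poly_mat (e * e) X = poly_mat (x * w) X" for p' e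
  proof -
    have "poly_mat (p' - (b + e)) X = 0" "poly_mat (e * e - x * w) X = 0"
      using that by (simp_all add: poly_mat_diff)
    moreover have "p' * p' - (b + b) * p' + 1 - 0 = (p' - (b + e)) * (p' - b + e) + (e * e - x * w) * 1"
      unfolding bb[symmetric] by (simp add: algebra_simps)
    ultimately have "poly_mat (p' * p' - (b + b) * p' + 1) X = poly_mat 0 X" by (rule poly_mat_eqI)
    then show ?thesis by simp
  qed
  have char_pq: "poly_mat (p * p - (b + b) * p + 1) X = 0" "poly_mat (q * q - (b + b) * q + 1) X = 0"
    using rr
    by (intro char[of p r] char[of q "- r"];
        simp only: p q r poly_mat_add poly_mat_uminus minus_mult_minus diff_conv_add_uminus)+
  show "c (Suc (Suc j)) = 2 *\<^sub>R c (Suc j) - c j + \<rho> *\<^sub>R (X *v c (Suc j))"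
    unfolding c power_step[OF char_pq(1)] power_step[OF char_pq(2)]
      matrix_vector_right_distrib scaleR_right_distrib by simp
qed

text \<open>As a first-order system in \<open>u\<close> and the difference quotient
  \<open>w\<close>, each step enlarges the sum of their norms by at most
  \<open>(1 + k * b) * (1 + k)\<close>, which is below \<open>exp ((1 + b) * k)\<close>. The growth
  factor thus depends on \<open>k\<close> and \<open>j\<close> only through the elapsed time
  \<open>k * real j\<close>.\<close>

lemma discrete_gronwall:
  fixes u :: "nat \<Rightarrow> 'a::real_normed_vector"
  assumes k: "k > 0" and b: "b \<ge> 0"
    and step: "\<And>j. u (Suc (Suc j)) = 2 *\<^sub>R u (Suc j) - u j + k\<^sup>2 *\<^sub>R L (u (Suc j))"
    and L: "\<And>x. norm (L x) \<le> b * norm x"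
  shows "norm (u j) \<le> exp ((1 + b) * (k * real j)) * (norm (u 0) + norm ((u 1 - u 0) /\<^sub>R k))"
proof -
  define w where "w j = (u (Suc j) - u j) /\<^sub>R k" for j
  have u_step: "u (Suc j) = u j + k *\<^sub>R w j" for j
    using k by (simp add: w_def)
  have w_step: "w (Suc j) = w j + k *\<^sub>R L (u (Suc j))" for j
  proof -
    have "k *\<^sub>R w (Suc j) = k *\<^sub>R (w j + k *\<^sub>R L (u (Suc j)))"
      using k by (simp add: w_def step scaleR_right_distrib power2_eq_square scaleR_2)
    then show ?thesis using k by simp
  qed
  have growth: "norm (u j) + norm (w j) \<le> ((1 + k * b) * (1 + k)) ^ j * (norm (u 0) + norm (w 0))"
  proof (induction j)
    case (Suc j)
    have 1: "norm (u (Suc j)) \<le> norm (u j) + k * norm (w j)"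
      unfolding u_step using k by (metis norm_triangle_ineq norm_scaleR abs_of_pos)
    have "norm (w (Suc j)) \<le> norm (w j) + k * norm (L (u (Suc j)))"
      unfolding w_step using k by (metis norm_triangle_ineq norm_scaleR abs_of_pos)
    also have "\<dots> \<le> norm (w j) + k * (b * norm (u (Suc j)))"
      using L k by (simp add: mult_left_mono)
    finally have "norm (u (Suc j)) + norm (w (Suc j)) \<le> (1 + k * b) * norm (u (Suc j)) + norm (w j)"
      by (simp add: algebra_simps)
    also have "\<dots> \<le> (1 + k * b) * (norm (u j) + k * norm (w j)) + (1 + k * b) * norm (w j)"
      using 1 k b by (intro add_mono mult_left_mono) (simp_all add: mult_le_cancel_right1)
    also have "\<dots> \<le> (1 + k * b) * (1 + k) * (norm (u j) + norm (w j))"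
      using k b by (simp add: algebra_simps)
    also have "\<dots> \<le> (1 + k * b) * (1 + k) * (((1 + k * b) * (1 + k)) ^ j * (norm (u 0) + norm (w 0)))"
      using Suc k b by (intro mult_left_mono) auto
    finally show ?case by (simp add: mult.assoc)
  qed simp
  have "(1 + k * b) * (1 + k) \<le> exp (k * b) * exp k"
    using k b by (intro mult_mono exp_ge_add_one_self) auto
  also have "\<dots> = exp ((1 + b) * k)"
    by (simp add: algebra_simps flip: exp_add)
  finally have "((1 + k * b) * (1 + k)) ^ j \<le> exp ((1 + b) * k) ^ j"
    using k b by (intro power_mono) auto
  also have "\<dots> = exp ((1 + b) * (k * real j))"
    by (simp add: exp_of_nat_mult[symmetric] mult_ac)
  finally have "((1 + k * b) * (1 + k)) ^ j * (norm (u 0) + norm (w 0))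
      \<le> exp ((1 + b) * (k * real j)) * (norm (u 0) + norm (w 0))"
    by (rule mult_right_mono) simp
  moreover have w0: "(u 1 - u 0) /\<^sub>R k = w 0" by (simp add: w_def)
  ultimately show ?thesis unfolding w0 using growth norm_ge_zero[of "w j"] by linarith
qed

section \<open>The discrete problem\<close>

lemma matrix_vector_mult_sum: "M *v (\<Sum>i\<in>I. f i) = (\<Sum>i\<in>I. M *v f i)" for M :: "complex^'n^'m"
  by (induction I rule: infinite_finite_induct) (auto simp: matrix_vector_right_distrib)

lemma matrix_vector_scaleR: "M *v (c *\<^sub>R u) = c *\<^sub>R (M *v u)"
  for M :: "'a::real_algebra_1^'n^'m"
  by (simp add: vec_eq_iff matrix_vector_mult_def scaleR_sum_right)

lemma matrix_vector_mult_weighted_sum: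
  "M *v ((\<Sum>i\<in>I. a i *\<^sub>R f i) /\<^sub>R n) = (\<Sum>i\<in>I. a i *\<^sub>R (M *v f i)) /\<^sub>R n"
  for M :: "complex^'n^'m"
  by (simp add: matrix_vector_mult_sum matrix_vector_scaleR)

lemma matrix_diff_ldistrib: "A ** (B - C) = A ** B - A ** C" for B C :: "'a::ring_1^'n^'m"
  by (simp add: vec_eq_iff matrix_matrix_mult_def right_diff_distrib sum_subtractf)

lemma stack_kernel:
  assumes "stack M L *v u = 0"
  shows "M *v u = 0" "L *v u = 0"
proof -
  have "(stack M L *v u) $ Inl i = (M *v u) $ i" "(stack M L *v u) $ Inr j = (L *v u) $ j" for i j
    by (simp_all add: stack_def matrix_vector_mult_def)
  with assms show "M *v u = 0" "L *v u = 0" by (simp_all add: vec_eq_iff)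
qed

text \<open>Brings the scheme into the form of second differences, in space under \<open>A\<close>
  and in time under \<open>E\<close>.\<close>

lemma wave_step_rearranged:
  "(c *\<^sub>R A) *v (a + b) + (2 *\<^sub>R (E - c *\<^sub>R A)) *v u - E *v (d + e)
    = c *\<^sub>R (A *v (a + b - 2 *\<^sub>R u)) - E *v (d + e - 2 *\<^sub>R u)"
  for A E :: "complex^'n^'n"
  by (simp add: scaleR_matrix_vector_mult matrix_vector_mult_diff_rdistrib matrix_vector_mult_diff_distrib
      matrix_vector_right_distrib matrix_vector_scaleR scaleR_right_diff_distrib scaleR_right_distrib)

theorem mainTheorem2:
  fixes N :: nat
    and T \<alpha> \<beta> :: real
    and \<gamma> :: complex
    and E A A\<^sub>1 A\<^sub>2 B\<^sub>1 B\<^sub>2 Eh Ah ED X :: "complex^'m^'m"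
    and \<G> :: "complex^'m^('m + 'm)"
    and \<G>p :: "complex^('m + 'm)^'m"
    and lam :: "nat \<Rightarrow> real"
    and v :: "nat \<Rightarrow> nat \<Rightarrow> real"
    and F G :: "nat \<Rightarrow> complex^'m"
    and K :: "real set"
    and \<rho> :: "real \<Rightarrow> nat \<Rightarrow> real"
    and Pp Pm :: "real \<Rightarrow> nat \<Rightarrow> complex poly"
    and Z\<^sub>0 Z\<^sub>1 YG :: "real \<Rightarrow> nat \<Rightarrow> complex^'m^'m"
    and P Q :: "real \<Rightarrow> nat \<Rightarrow> complex^'m"
    and U :: "real \<Rightarrow> nat \<Rightarrow> nat \<Rightarrow> complex^'m"
  assumes N: "N > 0" and T: "T > 0"
    and E_singular: "\<not> invertible E"
    and regular: "invertible (mat \<gamma> ** E + A)"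
    and Eh: "Eh = matrix_inv (mat \<gamma> ** E + A) ** E"
    and Ah: "Ah = matrix_inv (mat \<gamma> ** E + A) ** A"
    and ED: "is_drazin_inverse Eh ED"
    and X: "X = ED ** Ah"
    and nonzero_eigenvalue: "\<exists>z\<in>spectrum X. z \<noteq> 0"
    and eigenfunctions: "\<And>l. l \<in> {0<..<N} \<Longrightarrow> psd_eigenpair N \<alpha> \<beta> (lam l) (v l)"
    and eigenvalues: "bij_betw lam {0<..<N} {\<mu>. \<exists>w. psd_eigenpair N \<alpha> \<beta> \<mu> w}"
    and \<G>: "\<G> = stack (\<alpha> *\<^sub>R A\<^sub>1 - A\<^sub>2) (\<beta> *\<^sub>R B\<^sub>1 - B\<^sub>2)"
    and rank_\<G>: "rank \<G> < CARD('m)"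
    and \<G>p: "is_moore_penrose_inverse \<G> \<G>p"
    and F_bounded: "bounded (F ` {0..N})" and G_bounded: "bounded (G ` {0..N})"
    and hyp_a_F: "\<And>i. i \<le> N \<Longrightarrow> (Eh ** ED) *v F i = F i"
    and hyp_a_G: "\<And>i. i \<le> N \<Longrightarrow> (Eh ** ED) *v G i = G i"
    and hyp_b_kernel: "\<And>i. 0 < i \<Longrightarrow> i < N \<Longrightarrow> \<G> *v F i = 0 \<and> \<G> *v G i = 0"
    and hyp_b_invariant: "\<G> ** ED ** Ah ** (mat 1 - \<G>p ** \<G>) = 0"
    \<comment> \<open>compatibility of the data, without which the initial conditions fail: at \<open>i = 0\<close> and
        \<open>i = N\<close> they obey the boundary conditions of the eigenfunctions, and they have no
        component in the kernel of \<open>X\<close> (automatic from \<open>hyp_a_F\<close>, \<open>hyp_a_G\<close> if \<open>A\<close> is invertible)\<close>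
    and F_edge: "F 0 + (\<alpha> * real N) *\<^sub>R (F 1 - F 0) = 0"
                "F N + (\<beta> * real N) *\<^sub>R (F N - F (N - 1)) = 0"
    and G_edge: "G 0 + (\<alpha> * real N) *\<^sub>R (G 1 - G 0) = 0"
                "G N + (\<beta> * real N) *\<^sub>R (G N - G (N - 1)) = 0"
    and FG_range: "\<And>i. 0 < i \<Longrightarrow> i < N \<Longrightarrow> F i \<in> range ((*v) X) \<and> G i \<in> range ((*v) X)"
    \<comment> \<open>\<open>K\<close> is the set of time steps under consideration\<close>
    and K: "\<And>k. k \<in> K \<Longrightarrow> k > 0"
    and \<rho>: "\<And>k l. \<rho> k l = - ((k / (1 / real N))\<^sup>2 * lam l)"
    and hyp_c: "\<And>k l d. k \<in> K \<Longrightarrow> l \<in> {0<..<N} \<Longrightarrow> d \<in> spectrum X - {0} \<Longrightarrow>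
      of_real (\<rho> k l) * d * (1 + of_real (\<rho> k l) / 4 * d) \<noteq> 0"
    and hyp_d: "\<And>k l. k \<in> K \<Longrightarrow> l \<in> {0<..<N} \<Longrightarrow>
      \<rho> k l \<le> (k / (1 / real N))\<^sup>2 * Max ((\<lambda>s. \<bar>lam s\<bar>) ` {0<..<N})"
    and P_pm: "\<And>k l. k \<in> K \<Longrightarrow> l \<in> {0<..<N} \<Longrightarrow> P_pair X (\<rho> k l) (Pp k l) (Pm k l)"
    and Z\<^sub>0: "\<And>k l. Z\<^sub>0 k l = poly_mat (Pp k l) X ** Eh ** ED"
    and Z\<^sub>1: "\<And>k l. Z\<^sub>1 k l = poly_mat (Pm k l) X ** Eh ** ED"
    and YG: "\<And>k l. k \<in> K \<Longrightarrow> l \<in> {0<..<N} \<Longrightarrow>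
      is_generalized_inverse ((Z\<^sub>1 k l - Z\<^sub>0 k l) ** Eh ** ED) (YG k l)"
    \<comment> \<open>the signs are those for which \<open>P + Q = F\<close> and
        \<open>(Z\<^sub>0 - 1) P + (Z\<^sub>1 - 1) Q = k G\<close> in each mode, as the initial conditions require\<close>
    and P: "\<And>k l. P k l = YG k l *v
      ((\<Sum>i\<in>{1..N - 1}. v l i *\<^sub>R ((Z\<^sub>1 k l - mat 1) *v F i - k *\<^sub>R G i))
        /\<^sub>R (\<Sum>i\<in>{1..N - 1}. (v l i)\<^sup>2))"
    and Q: "\<And>k l. Q k l = YG k l *v
      ((\<Sum>i\<in>{1..N - 1}. v l i *\<^sub>R (k *\<^sub>R G i - (Z\<^sub>0 k l - mat 1) *v F i))
        /\<^sub>R (\<Sum>i\<in>{1..N - 1}. (v l i)\<^sup>2))"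
    and U: "\<And>k i j. U k i j = (\<Sum>l\<in>{1..N - 1}.
      v l i *\<^sub>R ((mat_pow (Z\<^sub>0 k l) j ** Eh ** ED) *v P k l
                + (mat_pow (Z\<^sub>1 k l) j ** Eh ** ED) *v Q k l))"
  shows "(\<forall>k\<in>K. discrete_solution N k E A A\<^sub>1 A\<^sub>2 B\<^sub>1 B\<^sub>2 F G (U k)) \<and> stable_on N T K U"
proof -

  \<comment> \<open>The Drazin projection and the matrix \<open>X\<close>\<close>
  define M where "M = mat \<gamma> ** E + A"
  define \<Phi> where "\<Phi> = Eh ** ED"
  have M_inv: "M ** matrix_inv M = mat 1" "matrix_inv M ** M = mat 1"
    using matrix_inv_inverse regular by (simp_all add: M_def)
  have E_eq: "E = M ** Eh" and A_eq: "A = M ** Ah"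
    unfolding Eh Ah M_def[symmetric] by (simp_all add: matrix_mul_assoc M_inv)
  have drazin: "ED ** Eh ** ED = ED" "ED ** Eh = Eh ** ED"
    using ED unfolding is_drazin_inverse_def by blast+
  have "mat \<gamma> ** Eh + Ah = mat 1"
  proof -
    have "mat \<gamma> ** Eh = matrix_inv M ** (mat \<gamma> ** E)"
      using mat_commute[of \<gamma> "matrix_inv M"] by (metis Eh M_def matrix_mul_assoc)
    moreover have "Ah = matrix_inv M ** A" unfolding Ah M_def ..
    ultimately have "mat \<gamma> ** Eh + Ah = matrix_inv M ** (mat \<gamma> ** E + A)"
      by (simp only: matrix_add_ldistrib)
    then show ?thesis using M_inv(2) by (simp add: M_def)
  qed
  \<comment> \<open>\<open>Ah\<close> is affine in \<open>Eh\<close>, so whatever commutes with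
    \<open>Eh\<close> commutes with \<open>Ah\<close>.\<close>
  then have Ah_eq: "Ah = mat 1 - mat \<gamma> ** Eh" by (simp add: eq_diff_eq add.commute)
  have Ah_comm: "L ** Ah = Ah ** L" if "L ** Eh = Eh ** L" for L
  proof -
    have "L ** (mat \<gamma> ** Eh) = mat \<gamma> ** Eh ** L"
      by (metis mat_commute matrix_mul_assoc that)
    then show ?thesis unfolding Ah_eq by (simp add: matrix_diff_rdistrib matrix_diff_ldistrib)
  qed
  have \<Phi>_comm: "\<Phi> ** Ah = Ah ** \<Phi>"
    by (rule Ah_comm) (metis \<Phi>_def drazin(2) matrix_mul_assoc)
  have \<Phi>_ED: "\<Phi> ** ED = ED" "ED ** \<Phi> = ED"
    using drazin unfolding \<Phi>_def by (metis, metis matrix_mul_assoc)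
  have \<Phi>_idem: "\<Phi> ** \<Phi> = \<Phi>"
    using \<Phi>_ED(2) by (simp add: \<Phi>_def flip: matrix_mul_assoc)
  have \<Phi>_X: "\<Phi> ** X = X" "X ** \<Phi> = X"
    unfolding X by (metis \<Phi>_ED(1) matrix_mul_assoc, metis \<Phi>_ED(2) \<Phi>_comm matrix_mul_assoc)
  \<comment> \<open>On the range of \<open>\<Phi>\<close> this lets \<open>X\<close> play the part
    of the inverse of \<open>E\<close> times \<open>A\<close>, although \<open>E\<close> is
    singular.\<close>
  have EX: "E ** X = A ** \<Phi>"
    unfolding E_eq A_eq X by (metis \<Phi>_comm \<Phi>_def matrix_mul_assoc)
  have X_singular: "\<not> invertible X"
  proof
    assume "invertible X"
    then obtain L where "X ** L = mat 1" by (auto simp: invertible_def)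
    then have "\<Phi> = mat 1" by (metis \<Phi>_X(1) matrix_mul_assoc matrix_mul_rid)
    then have "invertible Eh" unfolding invertible_def \<Phi>_def using drazin(2) by metis
    moreover have "invertible M" using regular by (simp add: M_def)
    ultimately have "invertible E" unfolding E_eq by (metis invertible_mult)
    with E_singular show False by contradiction
  qed
  \<comment> \<open>On the kernel of \<open>\<G>\<close> the factor
    \<open>mat 1 - \<G>p ** \<G>\<close> acts as the identity, so the second part of condition (b)
    says that \<open>X\<close> preserves this kernel.\<close>
  have ker_X: "\<G> *v (X *v u) = 0" if "\<G> *v u = 0" for u
  proof -
    have "(mat 1 - \<G>p ** \<G>) *v u = u"
      using that by (simp add: matrix_vector_mult_diff_rdistrib flip: matrix_vector_mul_assoc)
    then have "\<G> *v (X *v u) = (\<G> ** ED ** Ah ** (mat 1 - \<G>p ** \<G>)) *v u"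
      by (simp add: X flip: matrix_vector_mul_assoc)
    then show ?thesis by (simp add: hyp_b_invariant)
  qed

  \<comment> \<open>Coefficients of the data in the eigenfunctions\<close>
  let ?I = "{1..N - 1}"
  have mem: "l \<in> {0<..<N}" if "l \<in> ?I" for l using that by auto
  define coef where "coef H l = (\<Sum>i\<in>?I. v l i *\<^sub>R H i) /\<^sub>R (\<Sum>i\<in>?I. (v l i)\<^sup>2)"
    for H :: "nat \<Rightarrow> complex^'m" and l
  have coef_mult: "L *v coef H l = coef (\<lambda>i. L *v H i) l" for L H l
    unfolding coef_def by (rule matrix_vector_mult_weighted_sum)
  have coef_cong: "coef H l = coef H' l" if "\<And>i. 0 < i \<Longrightarrow> i < N \<Longrightarrow> H i = H' i" for H H' l
    unfolding coef_def using that by (intro arg_cong2[of _ _ _ _ scaleR] sum.cong refl) auto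
  have coef_range: "coef H l \<in> range ((*v) X)" if "\<And>i. 0 < i \<Longrightarrow> i < N \<Longrightarrow> H i \<in> range ((*v) X)" for H l
  proof -
    have "\<forall>i. \<exists>y. 0 < i \<and> i < N \<longrightarrow> H i = X *v y" using that by blast
    then obtain y where "\<And>i. 0 < i \<Longrightarrow> i < N \<Longrightarrow> H i = X *v y i" by metis
    then have "coef H l = X *v coef y l" unfolding coef_mult by (rule coef_cong)
    then show ?thesis by blast
  qed
  have coef_kernel: "\<G> *v coef H l = 0" if "\<And>i. 0 < i \<Longrightarrow> i < N \<Longrightarrow> \<G> *v H i = 0" for H l
    unfolding coef_def matrix_vector_mult_weighted_sum using that by (auto intro!: sum.neutral)
  have coef_FG: "coef F l \<in> range ((*v) X)" "coef G l \<in> range ((*v) X)"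
    "\<G> *v coef F l = 0" "\<G> *v coef G l = 0" for l
    by (simp_all add: FG_range hyp_b_kernel coef_range coef_kernel)
  \<comment> \<open>Valid at the two ends as well, thanks to the scalar boundary conditions imposed
    on the data.\<close>
  have expansion_F: "(\<Sum>l\<in>?I. v l i *\<^sub>R coef F l) = F i" if "i \<le> N" for i
    unfolding coef_def by (rule psd_expansion[OF N eigenfunctions eigenvalues F_edge that])
  have expansion_G: "(\<Sum>l\<in>?I. v l i *\<^sub>R coef G l) = G i" if "i \<le> N" for i
    unfolding coef_def by (rule psd_expansion[OF N eigenfunctions eigenvalues G_edge that])

  \<comment> \<open>The individual modes\<close>
  define c where "c k l j = (mat_pow (Z\<^sub>0 k l) j ** \<Phi>) *v P k l + (mat_pow (Z\<^sub>1 k l) j ** \<Phi>) *v Q k l"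
    for k l j
  have U_c: "U k i j = (\<Sum>l\<in>?I. v l i *\<^sub>R c k l j)" for k i j
    unfolding U c_def \<Phi>_def matrix_mul_assoc ..
  have c_init: "c k l 0 = coef F l" "c k l 1 = coef F l + k *\<^sub>R coef G l"
    and c_step: "c k l (Suc (Suc j)) = 2 *\<^sub>R c k l (Suc j) - c k l j + \<rho> k l *\<^sub>R (X *v c k l (Suc j))"
    if k: "k \<in> K" and l: "l \<in> ?I" for k l j
  proof -
    note kl = k mem[OF l]
    have \<rho>_nz: "\<rho> k l \<noteq> 0"
      using nonzero_eigenvalue hyp_c[OF kl] by fastforce
    have nonresonant: "1 + of_real (\<rho> k l) / 4 * d \<noteq> 0" if "d \<in> spectrum X - {0}" for d
      using hyp_c[OF kl that] by auto
    have Z: "Z\<^sub>0 k l = poly_mat (Pp k l) X ** \<Phi>" "Z\<^sub>1 k l = poly_mat (Pm k l) X ** \<Phi>"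
      by (simp_all add: Z\<^sub>0 Z\<^sub>1 \<Phi>_def matrix_mul_assoc)
    have YG': "is_generalized_inverse ((Z\<^sub>1 k l - Z\<^sub>0 k l) ** \<Phi>) (YG k l)"
      using YG[OF kl] by (simp add: \<Phi>_def matrix_mul_assoc)
    have kG: "k *\<^sub>R coef G l \<in> range ((*v) X)"
      using coef_FG(2)[of l] by (auto simp flip: matrix_vector_scaleR)
    \<comment> \<open>Linear maps commute with taking coefficients, so the formulas for
      \<open>P\<close> and \<open>Q\<close> become those of a single mode with increment
      \<open>k *\<^sub>R coef G l\<close>.\<close>
    have PQ: "P k l = YG k l *v ((Z\<^sub>1 k l - mat 1) *v coef F l - k *\<^sub>R coef G l)"
      "Q k l = YG k l *v (k *\<^sub>R coef G l - (Z\<^sub>0 k l - mat 1) *v coef F l)"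
      unfolding P Q coef_mult
      by (simp_all add: coef_def scaleR_right_diff_distrib sum_subtractf scaleR_sum_right mult_ac)
    note mode = mode_solution[OF \<Phi>_idem \<Phi>_X X_singular \<rho>_nz nonresonant P_pm[OF kl] Z YG' coef_FG(1) kG]
    show "c k l 0 = coef F l"
      unfolding c_def PQ by (rule mode(1))
    show "c k l 1 = coef F l + k *\<^sub>R coef G l"
      unfolding c_def PQ by (rule mode(2))
    show "c k l (Suc (Suc j)) = 2 *\<^sub>R c k l (Suc j) - c k l j + \<rho> k l *\<^sub>R (X *v c k l (Suc j))"
      unfolding c_def PQ by (rule mode(3))
  qed
  \<comment> \<open>Both properties hold for the first two terms and are preserved by the three-term
    recurrence, as \<open>X\<close> maps into the range of \<open>\<Phi>\<close> and respects the
    kernel of \<open>\<G>\<close>.\<close>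
  have c_invariant: "\<Phi> *v c k l j = c k l j \<and> \<G> *v c k l j = 0" if k: "k \<in> K" and l: "l \<in> ?I" for k l j
  proof (induction j rule: induct_nat_012)
    have \<Phi>_range: "\<Phi> *v u = u" if "u \<in> range ((*v) X)" for u
      using that \<Phi>_X(1) by (auto simp: matrix_vector_mul_assoc)
    note \<Phi>_range[OF coef_FG(1)] \<Phi>_range[OF coef_FG(2)]
    then show "\<Phi> *v c k l 0 = c k l 0 \<and> \<G> *v c k l 0 = 0"
      "\<Phi> *v c k l (Suc 0) = c k l (Suc 0) \<and> \<G> *v c k l (Suc 0) = 0"
      using c_init[OF k l] coef_FG[of l]
      by (simp_all add: matrix_vector_right_distrib matrix_vector_scaleR)
  next
    fix j
    assume IH: "\<Phi> *v c k l j = c k l j \<and> \<G> *v c k l j = 0"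
      "\<Phi> *v c k l (Suc j) = c k l (Suc j) \<and> \<G> *v c k l (Suc j) = 0"
    have "\<Phi> *v (X *v u) = X *v u" for u by (simp add: matrix_vector_mul_assoc \<Phi>_X)
    with IH ker_X show "\<Phi> *v c k l (Suc (Suc j)) = c k l (Suc (Suc j)) \<and> \<G> *v c k l (Suc (Suc j)) = 0"
      unfolding c_step[OF k l]
      by (simp add: matrix_vector_right_distrib matrix_vector_mult_diff_distrib matrix_vector_scaleR)
  qed
  have c_boundary: "A\<^sub>2 *v c k l j = \<alpha> *\<^sub>R (A\<^sub>1 *v c k l j)" "B\<^sub>2 *v c k l j = \<beta> *\<^sub>R (B\<^sub>1 *v c k l j)"
    if "k \<in> K" "l \<in> ?I" for k l j
    using stack_kernel[of "\<alpha> *\<^sub>R A\<^sub>1 - A\<^sub>2" "\<beta> *\<^sub>R B\<^sub>1 - B\<^sub>2" "c k l j"] c_invariant[OF that, of j]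
    by (simp_all add: \<G> matrix_vector_mult_diff_rdistrib scaleR_matrix_vector_mult)

  \<comment> \<open>Verification of the discrete problem\<close>
  have "discrete_solution N k E A A\<^sub>1 A\<^sub>2 B\<^sub>1 B\<^sub>2 F G (U k)" if k: "k \<in> K" for k
    unfolding discrete_solution_def Let_def
  proof (intro conjI allI impI)
    fix i j :: nat
    assume ij: "0 < i \<and> i < N \<and> 0 < j"
    define q where "q = (k / (1 / real N))\<^sup>2"
    obtain j' where j': "j = Suc j'" using ij gr0_implies_Suc by blast
    have space: "U k (i + 1) j + U k (i - 1) j - 2 *\<^sub>R U k i j = (\<Sum>l\<in>?I. (- lam l * v l i) *\<^sub>R c k l j)"
    proof -
      have "U k (i + 1) j + U k (i - 1) j - 2 *\<^sub>R U k i j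
          = (\<Sum>l\<in>?I. (v l (i + 1) + v l (i - 1) - 2 * v l i) *\<^sub>R c k l j)"
        unfolding U_c by (simp add: scaleR_left_distrib scaleR_left_diff_distrib sum.distrib sum_subtractf
            scaleR_sum_right)
      also have "\<dots> = (\<Sum>l\<in>?I. (- lam l * v l i) *\<^sub>R c k l j)"
        using psd_eigenpair_step[OF eigenfunctions[OF mem]] ij by (intro sum.cong refl) simp
      finally show ?thesis .
    qed
    have time: "U k i (j + 1) + U k i (j - 1) - 2 *\<^sub>R U k i j
        = (\<Sum>l\<in>?I. (\<rho> k l * v l i) *\<^sub>R (X *v c k l j))"
    proof -
      have "U k i (j + 1) + U k i (j - 1) - 2 *\<^sub>R U k i j
          = (\<Sum>l\<in>?I. v l i *\<^sub>R (c k l (Suc (Suc j')) + c k l j' - 2 *\<^sub>R c k l (Suc j')))"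
        unfolding U_c j' by (simp add: scaleR_right_distrib scaleR_right_diff_distrib sum.distrib sum_subtractf
            scaleR_sum_right mult.commute)
      also have "\<dots> = (\<Sum>l\<in>?I. (\<rho> k l * v l i) *\<^sub>R (X *v c k l j))"
        using c_step[OF k] by (intro sum.cong refl) (simp add: j' mult.commute)
      finally show ?thesis .
    qed
    have EXA: "E *v (X *v c k l j) = A *v c k l j" if "l \<in> ?I" for l
      using c_invariant[OF k that, of j] by (metis EX matrix_vector_mul_assoc)
    have "q *\<^sub>R (A *v (U k (i + 1) j + U k (i - 1) j - 2 *\<^sub>R U k i j))
        = E *v (U k i (j + 1) + U k i (j - 1) - 2 *\<^sub>R U k i j)"
      unfolding space time matrix_vector_mult_sum matrix_vector_scaleR scaleR_sum_right
      by (intro sum.cong refl) (simp add: EXA \<rho> q_def)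
    then show "((k / (1 / real N))\<^sup>2 *\<^sub>R A) *v (U k (i + 1) j + U k (i - 1) j)
        + (2 *\<^sub>R (E - (k / (1 / real N))\<^sup>2 *\<^sub>R A)) *v U k i j - E *v (U k i (j + 1) + U k i (j - 1)) = 0"
      unfolding q_def[symmetric] wave_step_rearranged by simp
  next
    fix j :: nat
    \<comment> \<open>The kernel condition turns \<open>A\<^sub>2\<close> into
      \<open>\<alpha>\<close> times \<open>A\<^sub>1\<close> on each mode, leaving the scalar
      boundary expression of \<open>v l\<close> as a factor. The other end is analogous.\<close>
    have "A\<^sub>1 *v U k 0 j + real N *\<^sub>R (A\<^sub>2 *v (U k 1 j - U k 0 j))
        = (\<Sum>l\<in>?I. (v l 0 + \<alpha> * real N * (v l 1 - v l 0)) *\<^sub>R (A\<^sub>1 *v c k l j))"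
      unfolding U_c sum_subtractf[symmetric] scaleR_left_diff_distrib[symmetric]
        matrix_vector_mult_sum matrix_vector_scaleR scaleR_sum_right sum.distrib[symmetric]
      by (intro sum.cong refl) (simp add: c_boundary[OF k] scaleR_left_distrib mult_ac)
    also have "\<dots> = 0"
      using eigenfunctions[OF mem] by (intro sum.neutral ballI) (simp add: psd_eigenpair_def)
    finally show "A\<^sub>1 *v U k 0 j + real N *\<^sub>R (A\<^sub>2 *v (U k 1 j - U k 0 j)) = 0" .
  next
    fix j :: nat
    have "B\<^sub>1 *v U k N j + real N *\<^sub>R (B\<^sub>2 *v (U k N j - U k (N - 1) j))
        = (\<Sum>l\<in>?I. (v l N + \<beta> * real N * (v l N - v l (N - 1))) *\<^sub>R (B\<^sub>1 *v c k l j))"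
      unfolding U_c sum_subtractf[symmetric] scaleR_left_diff_distrib[symmetric]
        matrix_vector_mult_sum matrix_vector_scaleR scaleR_sum_right sum.distrib[symmetric]
      by (intro sum.cong refl) (simp add: c_boundary[OF k] scaleR_left_distrib mult_ac)
    also have "\<dots> = 0"
      using eigenfunctions[OF mem] by (intro sum.neutral ballI) (simp add: psd_eigenpair_def)
    finally show "B\<^sub>1 *v U k N j + real N *\<^sub>R (B\<^sub>2 *v (U k N j - U k (N - 1) j)) = 0" .
  next
    fix i assume i: "i \<le> N"
    show U0: "U k i 0 = F i"
      using expansion_F[OF i] c_init(1)[OF k] by (simp add: U_c)
    have "U k i 1 = (\<Sum>l\<in>?I. v l i *\<^sub>R coef F l) + k *\<^sub>R (\<Sum>l\<in>?I. v l i *\<^sub>R coef G l)"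
      using c_init(2)[OF k] by (simp add: U_c scaleR_right_distrib sum.distrib scaleR_sum_right mult.commute)
    then show "(U k i 1 - U k i 0) /\<^sub>R k = G i"
      using expansion_F[OF i] expansion_G[OF i] U0 K[OF k] by simp
  qed

  \<comment> \<open>Stability for fixed spatial step and final time\<close>
  moreover have "stable_on N T K U"
  proof -
    obtain B where B: "B > 0" "\<And>u. norm (X *v u) \<le> norm u * B"
      using bounded_linear.pos_bounded[OF matrix_vector_mul_bounded_linear[of X]] by blast
    \<comment> \<open>Since \<open>\<rho> k l\<close> is \<open>k\<close> squared times
      \<open>- ((real N)\<^sup>2 * lam l)\<close>, this is a bound, independent of \<open>k\<close>,
      for the operator in the Gronwall estimate.\<close>
    define b where "b l = (real N)\<^sup>2 * \<bar>lam l\<bar> * B" for l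
    define D where "D l = exp ((1 + b l) * T) * (norm (coef F l) + norm (coef G l))" for l
    \<comment> \<open>Adding over all interior \<open>i\<close> gives one constant for every mesh
      point; neither \<open>D\<close> nor \<open>C\<close> involves the time step.\<close>
    define C where "C = (\<Sum>i\<in>?I. \<Sum>l\<in>?I. \<bar>v l i\<bar> * D l)"
    have b_nonneg: "b l \<ge> 0" for l using B(1) by (simp add: b_def)
    have D_nonneg: "D l \<ge> 0" for l by (simp add: D_def)
    have "norm (U k i j) \<le> C" if k: "k \<in> K" and kM: "k * real M = T" and i: "i \<in> ?I" and j: "j \<in> {1..M}"
      for k M i j
    proof -
      have c_bound: "norm (c k l j) \<le> D l" if l: "l \<in> ?I" for l
      proof -
        define L where "L = (\<lambda>u. (- ((real N)\<^sup>2 * lam l)) *\<^sub>R (X *v u))"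
        have "norm (c k l j) \<le> exp ((1 + b l) * (k * real j)) * (norm (c k l 0) + norm ((c k l 1 - c k l 0) /\<^sub>R k))"
        proof (rule discrete_gronwall[where L = L, OF K[OF k] b_nonneg])
          show "c k l (Suc (Suc j)) = 2 *\<^sub>R c k l (Suc j) - c k l j + k\<^sup>2 *\<^sub>R L (c k l (Suc j))" for j
            unfolding c_step[OF k l] by (simp add: L_def \<rho> power_mult_distrib)
          show "norm (L u) \<le> b l * norm u" for u
            using mult_left_mono[OF B(2), of "(real N)\<^sup>2 * \<bar>lam l\<bar>" u]
            by (simp add: L_def b_def abs_mult mult_ac)
        qed
        \<comment> \<open>The initial difference quotient is exactly the mode of \<open>G\<close>,
          so dividing by \<open>k\<close> leaves no dependence on the time step.\<close>
        also have "norm (c k l 0) + norm ((c k l 1 - c k l 0) /\<^sub>R k) = norm (coef F l) + norm (coef G l)"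
          using K[OF k] unfolding c_init[OF k l] by simp
        also have "exp ((1 + b l) * (k * real j)) * (norm (coef F l) + norm (coef G l)) \<le> D l"
        proof -
          have "k * real j \<le> T"
            using j K[OF k] unfolding kM[symmetric] by (intro mult_left_mono) auto
          then show ?thesis
            unfolding D_def using b_nonneg[of l] by (intro mult_right_mono) (simp_all add: mult_left_mono)
        qed
        finally show ?thesis .
      qed
      have "norm (U k i j) \<le> (\<Sum>l\<in>?I. \<bar>v l i\<bar> * D l)"
        unfolding U_c using c_bound by (intro sum_norm_le) (simp add: mult_left_mono)
      also have "\<dots> \<le> C"
        unfolding C_def using i D_nonneg
        by (intro member_le_sum[of i ?I "\<lambda>i. \<Sum>l\<in>?I. \<bar>v l i\<bar> * D l"]) (auto intro!: sum_nonneg)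
      finally show ?thesis .
    qed
    then show ?thesis unfolding stable_on_def by blast
  qed
  ultimately show ?thesis by blast
qed

end
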